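(* Let $\mathbf{F}=(F,\delta,\xi)$ be a comonad in a Grothendieck category $\mathcal{A}$ such that $F$ is right exact and commutes with direct sums. Let $\mathsf{w}:\mathscr K(F)\to F^2$ be the universal cointegration and $\mathsf{d}:\mathscr K(F)\to F$ the universal coderivation associated to the $\mathbf{F}$-bicomodule $(F,\delta,\delta)$. The following are equivalent: (i) the sequence $0\to F\xrightarrow{\delta}F^2\xrightarrow{\delta^c}\mathscr{K}(F)\to0$ is a split sequence in the category of bicomodules ${}^{\mathbf{F}}\mathcal{M}^{\mathbf{F}}$; (ii) the universal cointegration $\mathsf{w}$ is inner; (iii) the universal coderivation $\mathsf{d}$ is inner.
   Context: Functors are additive. A comonad $\mathbf F=(F,\delta,\xi)$ in $\mathcal A$ is an endofunctor $F$ with natural transformations $\delta:F\to F^2$, $\xi:F\to \mathrm{id}_{\mathcal A}$ such that $\delta_F\circ\delta=F\delta\circ\delta$ and $F\xi\circ\delta=\xi_F\circ\delta=F$ (an object or functor also denotes its identity). For a natural transformation $\beta$ and functors $H,I$, $\beta_I$ has components $\beta_{I(Z)}$ and $H\beta$ has components $H(\beta_X)$. $\overline{\mathrm{Funt}}(\mathcal A,\mathcal A)$ is the category of additive functors $\mathcal A\to\mathcal A$ preserving cokernels and commuting with direct sums. ${}_{\mathcal A}\mathcal M^{\mathbf F}$: objects $(\mathsf M,\mathfrak m)$ with $\mathsf M\in\overline{\mathrm{Funt}}(\mathcal A,\mathcal A)$ and $\mathfrak m:\mathsf M\to F\mathsf M$ natural with $\delta_{\mathsf M}\circ\mathfrak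 m=F\mathfrak m\circ\mathfrak m$, $\xi_{\mathsf M}\circ\mathfrak m=\mathsf M$; morphisms are natural $f:\mathsf M\to\mathsf M'$ with $\mathfrak m'\circ f=Ff\circ\mathfrak m$. ${}^{\mathbf F}\mathcal M^{\mathbf F}$ ($\mathbf F$-bicomodules): objects $(\mathsf M,\mathfrak m,\mathfrak n)$ with $(\mathsf M,\mathfrak m)\in{}_{\mathcal A}\mathcal M^{\mathbf F}$ and $\mathfrak n:\mathsf M\to\mathsf MF$ natural with $\mathsf M\delta\circ\mathfrak n=\mathfrak n_F\circ\mathfrak n$, $\mathsf M\xi\circ\mathfrak n=\mathsf M$, $\mathfrak m_F\circ\mathfrak n=F\mathfrak n\circ\mathfrak m$; morphisms are natural $f$ with $\mathfrak m'\circ f=Ff\circ\mathfrak m$ and $\mathfrak n'\circ f=f_F\circ\mathfrak n$. $F$ and $F^2$ denote the bicomodules $(F,\delta,\delta)$ and $(F^2,\delta_F,F\delta)$. These categories are preadditive with cokernels. Let $\delta^c:F^2\to(\mathscr K(F),\mathfrak u,\mathfrak v)$ be the cokernel of $\delta:F\to F^2$ in ${}^{\mathbf F}\mathcal M^{\mathbf F}$ (it remains a cokernel in ${}_{\mathcal A}\mathcal M^{\mathbf F}$ after forgetting $\mathfrak v$). $\mathsf w:\mathscr K(F)\to F^2$ is the unique morphism of ${}_{\mathcal A}\mathcal M^{\mathbf F}$ with $\mathsf w\circ\delta^c=F^2-\delta\circ F\xi$, and $\mathsf d=F\xi\circ\mathsf w-\xi_F\circ\mathsf w$. A cointegration from $(\mathsf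 M,\mathfrak m,\mathfrak n)$ into $(\mathsf M',\mathfrak m',\mathfrak n')$ is a natural transformation $h:\mathsf M\to\mathsf M'F$ with $\mathfrak m'_F\circ h=Fh\circ\mathfrak m$ and $\mathsf M'\delta\circ h=\mathfrak n'_F\circ h+h_F\circ\mathfrak n$; it is inner if there is a natural $\varphi:\mathsf M\to\mathsf M'$ with $\mathfrak m'\circ\varphi=F\varphi\circ\mathfrak m$ and $h=\varphi_F\circ\mathfrak n-\mathfrak n'\circ\varphi$. A coderivation from $(\mathsf M,\mathfrak m,\mathfrak n)$ to $F$ is a natural $g:\mathsf M\to F$ with $\delta\circ g=Fg\circ\mathfrak m+g_F\circ\mathfrak n$; it is inner if $g=\lambda_F\circ\mathfrak n-F\lambda\circ\mathfrak m$ for some natural $\lambda:\mathsf M\to\mathrm{id}_{\mathcal A}$. A sequence $X\xrightarrow{i}X'\xrightarrow{j}X''$ ($j\circ i=0$) is cosplit if $i$ has a cokernel and the induced $l:\mathrm{Coker}(i)\to X''$ is a split monomorphism; split is the dual notion using kernels; longer diagrams are (co)split if each consecutive pair is, and for short sequences $0\to X\to X'\to X''\to 0$ split and cosplit agree. *)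

theory Defs
  imports Main "HOL-Library.FuncSet" "HOL-Library.Equipollence"
begin

section \<open>Preadditive categories\<close>

text \<open>Objects form a set in an arbitrary type, hom-sets are pairwise disjoint, and composition,
  addition and negation are only meaningful on (composable, parallel) morphisms.\<close>

record ('o, 'm) precat =
  Obj :: "'o set"
  Hom :: "'o \<Rightarrow> 'o \<Rightarrow> 'm set"
  Ident :: "'o \<Rightarrow> 'm"
  Comp :: "'m \<Rightarrow> 'm \<Rightarrow> 'm" (infixr "\<cdot>\<index>" 75)
  Zero :: "'o \<Rightarrow> 'o \<Rightarrow> 'm"
  Add :: "'m \<Rightarrow> 'm \<Rightarrow> 'm" (infixl "\<oplus>\<index>" 65)
  Neg :: "'m \<Rightarrow> 'm"

locale preadditive_category =
  fixes C :: "('o, 'm) precat" (structure)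
  assumes hom_obj: "f \<in> Hom C X Y \<Longrightarrow> X \<in> Obj C \<and> Y \<in> Obj C"
    and hom_disjoint: "\<lbrakk>f \<in> Hom C X Y; f \<in> Hom C X' Y'\<rbrakk> \<Longrightarrow> X = X' \<and> Y = Y'"
    and ident_hom: "X \<in> Obj C \<Longrightarrow> Ident C X \<in> Hom C X X"
    and comp_hom: "\<lbrakk>f \<in> Hom C X Y; g \<in> Hom C Y Z\<rbrakk> \<Longrightarrow> g \<cdot> f \<in> Hom C X Z"
    and ident_left: "f \<in> Hom C X Y \<Longrightarrow> Ident C Y \<cdot> f = f"
    and ident_right: "f \<in> Hom C X Y \<Longrightarrow> f \<cdot> Ident C X = f"
    and comp_assoc: "\<lbrakk>f \<in> Hom C W X; g \<in> Hom C X Y; h \<in> Hom C Y Z\<rbrakk>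
      \<Longrightarrow> (h \<cdot> g) \<cdot> f = h \<cdot> (g \<cdot> f)"
    and zero_hom: "\<lbrakk>X \<in> Obj C; Y \<in> Obj C\<rbrakk> \<Longrightarrow> Zero C X Y \<in> Hom C X Y"
    and add_hom: "\<lbrakk>f \<in> Hom C X Y; g \<in> Hom C X Y\<rbrakk> \<Longrightarrow> f \<oplus> g \<in> Hom C X Y"
    and neg_hom: "f \<in> Hom C X Y \<Longrightarrow> Neg C f \<in> Hom C X Y"
    and add_assoc: "\<lbrakk>f \<in> Hom C X Y; g \<in> Hom C X Y; h \<in> Hom C X Y\<rbrakk>
      \<Longrightarrow> (f \<oplus> g) \<oplus> h = f \<oplus> (g \<oplus> h)"
    and add_commute: "\<lbrakk>f \<in> Hom C X Y; g \<in> Hom C X Y\<rbrakk> \<Longrightarrow> f \<oplus> g = g \<oplus> f"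
    and add_zero: "f \<in> Hom C X Y \<Longrightarrow> f \<oplus> Zero C X Y = f"
    and add_neg: "f \<in> Hom C X Y \<Longrightarrow> f \<oplus> Neg C f = Zero C X Y"
    and comp_add_left: "\<lbrakk>f \<in> Hom C X Y; g \<in> Hom C Y Z; h \<in> Hom C Y Z\<rbrakk>
      \<Longrightarrow> (g \<oplus> h) \<cdot> f = g \<cdot> f \<oplus> h \<cdot> f"
    and comp_add_right: "\<lbrakk>f \<in> Hom C X Y; g \<in> Hom C X Y; h \<in> Hom C Y Z\<rbrakk>
      \<Longrightarrow> h \<cdot> (f \<oplus> g) = h \<cdot> f \<oplus> h \<cdot> g"

definition monic :: "('o, 'm) precat \<Rightarrow> 'o \<Rightarrow> 'o \<Rightarrow> 'm \<Rightarrow> bool" where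
  "monic C X Y f \<longleftrightarrow> f \<in> Hom C X Y \<and>
     (\<forall>W g h. g \<in> Hom C W X \<longrightarrow> h \<in> Hom C W X \<longrightarrow> f \<cdot>\<^bsub>C\<^esub> g = f \<cdot>\<^bsub>C\<^esub> h \<longrightarrow> g = h)"

definition epic :: "('o, 'm) precat \<Rightarrow> 'o \<Rightarrow> 'o \<Rightarrow> 'm \<Rightarrow> bool" where
  "epic C X Y f \<longleftrightarrow> f \<in> Hom C X Y \<and>
     (\<forall>Z g h. g \<in> Hom C Y Z \<longrightarrow> h \<in> Hom C Y Z \<longrightarrow> g \<cdot>\<^bsub>C\<^esub> f = h \<cdot>\<^bsub>C\<^esub> f \<longrightarrow> g = h)"

definition split_epi :: "('o, 'm) precat \<Rightarrow> 'o \<Rightarrow> 'o \<Rightarrow> 'm \<Rightarrow> bool" where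
  "split_epi C X Y f \<longleftrightarrow> f \<in> Hom C X Y \<and> (\<exists>s \<in> Hom C Y X. f \<cdot>\<^bsub>C\<^esub> s = Ident C Y)"

definition kernel :: "('o, 'm) precat \<Rightarrow> 'o \<Rightarrow> 'o \<Rightarrow> 'm \<Rightarrow> 'o \<Rightarrow> 'm \<Rightarrow> bool" where
  "kernel C X Y f K k \<longleftrightarrow> f \<in> Hom C X Y \<and> k \<in> Hom C K X \<and> f \<cdot>\<^bsub>C\<^esub> k = Zero C K Y \<and>
     (\<forall>W g. g \<in> Hom C W X \<longrightarrow> f \<cdot>\<^bsub>C\<^esub> g = Zero C W Y \<longrightarrow>
        (\<exists>!h. h \<in> Hom C W K \<and> k \<cdot>\<^bsub>C\<^esub> h = g))"

definition cokernel :: "('o, 'm) precat \<Rightarrow> 'o \<Rightarrow> 'o \<Rightarrow> 'm \<Rightarrow> 'o \<Rightarrow> 'm \<Rightarrow> bool" where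
  "cokernel C X Y f Q p \<longleftrightarrow> f \<in> Hom C X Y \<and> p \<in> Hom C Y Q \<and> p \<cdot>\<^bsub>C\<^esub> f = Zero C X Q \<and>
     (\<forall>Z g. g \<in> Hom C Y Z \<longrightarrow> g \<cdot>\<^bsub>C\<^esub> f = Zero C X Z \<longrightarrow>
        (\<exists>!h. h \<in> Hom C Q Z \<and> h \<cdot>\<^bsub>C\<^esub> p = g))"

definition zero_object :: "('o, 'm) precat \<Rightarrow> 'o \<Rightarrow> bool" where
  "zero_object C Z \<longleftrightarrow> Z \<in> Obj C \<and>
     (\<forall>X \<in> Obj C. (\<exists>!f. f \<in> Hom C X Z) \<and> (\<exists>!f. f \<in> Hom C Z X))"

definition coproduct ::
  "('o, 'm) precat \<Rightarrow> 'i set \<Rightarrow> ('i \<Rightarrow> 'o) \<Rightarrow> 'o \<Rightarrow> ('i \<Rightarrow> 'm) \<Rightarrow> bool" where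
  "coproduct C I D S \<iota> \<longleftrightarrow> S \<in> Obj C \<and> (\<forall>i \<in> I. \<iota> i \<in> Hom C (D i) S) \<and>
     (\<forall>Z \<in> Obj C. \<forall>g. (\<forall>i \<in> I. g i \<in> Hom C (D i) Z) \<longrightarrow>
        (\<exists>!h. h \<in> Hom C S Z \<and> (\<forall>i \<in> I. h \<cdot>\<^bsub>C\<^esub> \<iota> i = g i)))"

text \<open>The pair \<open>X \<rightarrow> Y \<rightarrow> Z\<close> is a split sequence: \<open>j\<close> has a kernel and the induced morphism
  from \<open>X\<close> into it is a split epimorphism.\<close>

definition split_pair :: "('o, 'm) precat \<Rightarrow> 'o \<Rightarrow> 'o \<Rightarrow> 'o \<Rightarrow> 'm \<Rightarrow> 'm \<Rightarrow> bool" where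
  "split_pair C X Y Z i j \<longleftrightarrow> i \<in> Hom C X Y \<and> j \<in> Hom C Y Z \<and> j \<cdot>\<^bsub>C\<^esub> i = Zero C X Z \<and>
     (\<exists>K k l. kernel C Y Z j K k \<and> l \<in> Hom C X K \<and> k \<cdot>\<^bsub>C\<^esub> l = i \<and> split_epi C X K l)"

definition split_short :: "('o, 'm) precat \<Rightarrow> 'o \<Rightarrow> 'o \<Rightarrow> 'o \<Rightarrow> 'm \<Rightarrow> 'm \<Rightarrow> bool" where
  "split_short C X Y Z i j \<longleftrightarrow>
     (\<exists>N. zero_object C N \<and> split_pair C N X Y (Zero C N X) i \<and>
          split_pair C X Y Z i j \<and> split_pair C Y Z N j (Zero C Z N))"


section \<open>Grothendieck categories\<close>

locale abelian_category = preadditive_category +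
  assumes has_zero: "\<exists>Z. zero_object C Z"
    and has_binary_coproducts: "\<lbrakk>X \<in> Obj C; Y \<in> Obj C\<rbrakk>
      \<Longrightarrow> \<exists>S \<iota>. coproduct C (UNIV :: bool set) (\<lambda>b. if b then X else Y) S \<iota>"
    and has_kernels: "f \<in> Hom C X Y \<Longrightarrow> \<exists>K k. kernel C X Y f K k"
    and has_cokernels: "f \<in> Hom C X Y \<Longrightarrow> \<exists>Q p. cokernel C X Y f Q p"
    and monic_is_kernel: "monic C X Y f \<Longrightarrow> \<exists>Z g. kernel C Y Z g X f"
    and epic_is_cokernel: "epic C X Y f \<Longrightarrow> \<exists>W g. cokernel C W X g Y f"

definition exact_at :: "('o, 'm) precat \<Rightarrow> 'o \<Rightarrow> 'o \<Rightarrow> 'o \<Rightarrow> 'm \<Rightarrow> 'm \<Rightarrow> bool" where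
  "exact_at C X Y Z f g \<longleftrightarrow> f \<in> Hom C X Y \<and> g \<in> Hom C Y Z \<and> g \<cdot>\<^bsub>C\<^esub> f = Zero C X Z \<and>
     (\<exists>K k e. kernel C Y Z g K k \<and> k \<cdot>\<^bsub>C\<^esub> e = f \<and> epic C X K e)"

definition short_exact :: "('o, 'm) precat \<Rightarrow> 'o \<Rightarrow> 'o \<Rightarrow> 'o \<Rightarrow> 'm \<Rightarrow> 'm \<Rightarrow> bool" where
  "short_exact C X Y Z f g \<longleftrightarrow> monic C X Y f \<and> exact_at C X Y Z f g \<and> epic C Y Z g"

definition directed_preorder :: "'i set \<Rightarrow> ('i \<Rightarrow> 'i \<Rightarrow> bool) \<Rightarrow> bool" where
  "directed_preorder J le \<longleftrightarrow> J \<noteq> {} \<and> (\<forall>i \<in> J. le i i) \<and>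
     (\<forall>i \<in> J. \<forall>j \<in> J. \<forall>k \<in> J. le i j \<longrightarrow> le j k \<longrightarrow> le i k) \<and>
     (\<forall>i \<in> J. \<forall>j \<in> J. \<exists>k \<in> J. le i k \<and> le j k)"

definition direct_system :: "('o, 'm) precat \<Rightarrow> 'i set \<Rightarrow> ('i \<Rightarrow> 'i \<Rightarrow> bool) \<Rightarrow>
    ('i \<Rightarrow> 'o) \<Rightarrow> ('i \<Rightarrow> 'i \<Rightarrow> 'm) \<Rightarrow> bool" where
  "direct_system C J le D t \<longleftrightarrow>
     (\<forall>i \<in> J. D i \<in> Obj C \<and> t i i = Ident C (D i)) \<and>
     (\<forall>i \<in> J. \<forall>j \<in> J. le i j \<longrightarrow> t i j \<in> Hom C (D i) (D j)) \<and>
     (\<forall>i \<in> J. \<forall>j \<in> J. \<forall>k \<in> J. le i j \<longrightarrow> le j k \<longrightarrow> t j k \<cdot>\<^bsub>C\<^esub> t i j = t i k)"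

definition system_morphism :: "('o, 'm) precat \<Rightarrow> 'i set \<Rightarrow> ('i \<Rightarrow> 'i \<Rightarrow> bool) \<Rightarrow>
    ('i \<Rightarrow> 'o) \<Rightarrow> ('i \<Rightarrow> 'i \<Rightarrow> 'm) \<Rightarrow> ('i \<Rightarrow> 'o) \<Rightarrow> ('i \<Rightarrow> 'i \<Rightarrow> 'm) \<Rightarrow> ('i \<Rightarrow> 'm) \<Rightarrow> bool" where
  "system_morphism C J le D t E r a \<longleftrightarrow>
     (\<forall>i \<in> J. a i \<in> Hom C (D i) (E i)) \<and>
     (\<forall>i \<in> J. \<forall>j \<in> J. le i j \<longrightarrow> a j \<cdot>\<^bsub>C\<^esub> t i j = r i j \<cdot>\<^bsub>C\<^esub> a i)"

definition cocone :: "('o, 'm) precat \<Rightarrow> 'i set \<Rightarrow> ('i \<Rightarrow> 'i \<Rightarrow> bool) \<Rightarrow>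
    ('i \<Rightarrow> 'o) \<Rightarrow> ('i \<Rightarrow> 'i \<Rightarrow> 'm) \<Rightarrow> 'o \<Rightarrow> ('i \<Rightarrow> 'm) \<Rightarrow> bool" where
  "cocone C J le D t L \<iota> \<longleftrightarrow> L \<in> Obj C \<and> (\<forall>i \<in> J. \<iota> i \<in> Hom C (D i) L) \<and>
     (\<forall>i \<in> J. \<forall>j \<in> J. le i j \<longrightarrow> \<iota> j \<cdot>\<^bsub>C\<^esub> t i j = \<iota> i)"

definition direct_limit :: "('o, 'm) precat \<Rightarrow> 'i set \<Rightarrow> ('i \<Rightarrow> 'i \<Rightarrow> bool) \<Rightarrow>
    ('i \<Rightarrow> 'o) \<Rightarrow> ('i \<Rightarrow> 'i \<Rightarrow> 'm) \<Rightarrow> 'o \<Rightarrow> ('i \<Rightarrow> 'm) \<Rightarrow> bool" where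
  "direct_limit C J le D t L \<iota> \<longleftrightarrow> cocone C J le D t L \<iota> \<and>
     (\<forall>Z g. cocone C J le D t Z g \<longrightarrow>
        (\<exists>!h. h \<in> Hom C L Z \<and> (\<forall>i \<in> J. h \<cdot>\<^bsub>C\<^esub> \<iota> i = g i)))"

text \<open>The type \<open>'u\<close> plays the role of the universe: a set is small when its cardinality is
  strictly below that of \<open>'u\<close>. For \<open>'u\<close> of strongly inaccessible cardinality this is smallness
  with respect to a Grothendieck universe; nothing more than infinity of \<open>'u\<close> is imposed.
  Small index sets can be taken inside \<open>'u\<close> itself, up to bijection.\<close>

definition small :: "'u itself \<Rightarrow> 'a set \<Rightarrow> bool" where
  "small U I \<longleftrightarrow> I \<prec> (UNIV :: 'u set)"

definition exact_direct_limits :: "'u itself \<Rightarrow> ('o, 'm) precat \<Rightarrow> bool" where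
  "exact_direct_limits U C \<longleftrightarrow>
     (\<forall>(J :: 'u set) le X s Y t Z r a b LX \<iota> LY \<kappa> LZ \<mu> a' b'.
        small U J \<longrightarrow> directed_preorder J le \<longrightarrow>
        direct_system C J le X s \<longrightarrow> direct_system C J le Y t \<longrightarrow> direct_system C J le Z r \<longrightarrow>
        system_morphism C J le X s Y t a \<longrightarrow> system_morphism C J le Y t Z r b \<longrightarrow>
        (\<forall>j \<in> J. short_exact C (X j) (Y j) (Z j) (a j) (b j)) \<longrightarrow>
        direct_limit C J le X s LX \<iota> \<longrightarrow> direct_limit C J le Y t LY \<kappa> \<longrightarrow>
        direct_limit C J le Z r LZ \<mu> \<longrightarrow>
        a' \<in> Hom C LX LY \<longrightarrow> (\<forall>j \<in> J. a' \<cdot>\<^bsub>C\<^esub> \<iota> j = \<kappa> j \<cdot>\<^bsub>C\<^esub> a j) \<longrightarrow>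
        b' \<in> Hom C LY LZ \<longrightarrow> (\<forall>j \<in> J. b' \<cdot>\<^bsub>C\<^esub> \<kappa> j = \<mu> j \<cdot>\<^bsub>C\<^esub> b j) \<longrightarrow>
        short_exact C LX LY LZ a' b')"

definition generator :: "('o, 'm) precat \<Rightarrow> 'o \<Rightarrow> bool" where
  "generator C G \<longleftrightarrow> G \<in> Obj C \<and>
     (\<forall>X Y f g. f \<in> Hom C X Y \<longrightarrow> g \<in> Hom C X Y \<longrightarrow> f \<noteq> g \<longrightarrow>
        (\<exists>h \<in> Hom C G X. f \<cdot>\<^bsub>C\<^esub> h \<noteq> g \<cdot>\<^bsub>C\<^esub> h))"

definition grothendieck_category :: "'u itself \<Rightarrow> ('o, 'm) precat \<Rightarrow> bool" where
  "grothendieck_category U C \<longleftrightarrow> infinite (UNIV :: 'u set) \<and> abelian_category C \<and>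
     (\<forall>X \<in> Obj C. \<forall>Y \<in> Obj C. small U (Hom C X Y)) \<and>
     (\<forall>(I :: 'u set) D. small U I \<longrightarrow> (\<forall>i \<in> I. D i \<in> Obj C) \<longrightarrow> (\<exists>S \<iota>. coproduct C I D S \<iota>)) \<and>
     exact_direct_limits U C \<and> (\<exists>G. generator C G)"


section \<open>Endofunctors and natural transformations\<close>

text \<open>All maps are extensional, i.e. \<open>undefined\<close> off the objects, resp. morphisms, of the category,
  so that equality of functors and of natural transformations is equality in HOL.\<close>

record ('o, 'm) endofunctor =
  FObj :: "'o \<Rightarrow> 'o"
  FMap :: "'m \<Rightarrow> 'm"

definition arrows :: "('o, 'm) precat \<Rightarrow> 'm set" where
  "arrows A = (\<Union>X \<in> Obj A. \<Union>Y \<in> Obj A. Hom A X Y)"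

definition additive_functor :: "('o, 'm) precat \<Rightarrow> ('o, 'm) endofunctor \<Rightarrow> bool" where
  "additive_functor A F \<longleftrightarrow>
     FObj F \<in> Obj A \<rightarrow>\<^sub>E Obj A \<and> FMap F \<in> extensional (arrows A) \<and>
     (\<forall>X Y f. f \<in> Hom A X Y \<longrightarrow> FMap F f \<in> Hom A (FObj F X) (FObj F Y)) \<and>
     (\<forall>X \<in> Obj A. FMap F (Ident A X) = Ident A (FObj F X)) \<and>
     (\<forall>X Y Z f g. f \<in> Hom A X Y \<longrightarrow> g \<in> Hom A Y Z \<longrightarrow>
        FMap F (g \<cdot>\<^bsub>A\<^esub> f) = FMap F g \<cdot>\<^bsub>A\<^esub> FMap F f) \<and>
     (\<forall>X Y f g. f \<in> Hom A X Y \<longrightarrow> g \<in> Hom A X Y \<longrightarrow>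
        FMap F (f \<oplus>\<^bsub>A\<^esub> g) = FMap F f \<oplus>\<^bsub>A\<^esub> FMap F g)"

definition right_exact :: "('o, 'm) precat \<Rightarrow> ('o, 'm) endofunctor \<Rightarrow> bool" where
  "right_exact A F \<longleftrightarrow>
     (\<forall>X Y Z f g. exact_at A X Y Z f g \<longrightarrow> epic A Y Z g \<longrightarrow>
        exact_at A (FObj F X) (FObj F Y) (FObj F Z) (FMap F f) (FMap F g) \<and>
        epic A (FObj F Y) (FObj F Z) (FMap F g))"

definition preserves_cokernels :: "('o, 'm) precat \<Rightarrow> ('o, 'm) endofunctor \<Rightarrow> bool" where
  "preserves_cokernels A F \<longleftrightarrow>
     (\<forall>X Y f Q p. cokernel A X Y f Q p \<longrightarrow>
        cokernel A (FObj F X) (FObj F Y) (FMap F f) (FObj F Q) (FMap F p))"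

definition commutes_with_direct_sums ::
  "'u itself \<Rightarrow> ('o, 'm) precat \<Rightarrow> ('o, 'm) endofunctor \<Rightarrow> bool" where
  "commutes_with_direct_sums U A F \<longleftrightarrow>
     (\<forall>(I :: 'u set) D S \<iota>. small U I \<longrightarrow> coproduct A I D S \<iota> \<longrightarrow>
        coproduct A I (\<lambda>i. FObj F (D i)) (FObj F S) (\<lambda>i. FMap F (\<iota> i)))"

text \<open>Additive endofunctors preserving cokernels and commuting with direct sums, the objects of
  Funt with an overline.\<close>

definition funt :: "'u itself \<Rightarrow> ('o, 'm) precat \<Rightarrow> ('o, 'm) endofunctor \<Rightarrow> bool" where
  "funt U A F \<longleftrightarrow> additive_functor A F \<and> preserves_cokernels A F \<and> commutes_with_direct_sums U A F"

definition id_functor :: "('o, 'm) precat \<Rightarrow> ('o, 'm) endofunctor" where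
  "id_functor A = \<lparr>FObj = (\<lambda>X \<in> Obj A. X), FMap = (\<lambda>f \<in> arrows A. f)\<rparr>"

definition fcomp ::
  "('o, 'm) precat \<Rightarrow> ('o, 'm) endofunctor \<Rightarrow> ('o, 'm) endofunctor \<Rightarrow> ('o, 'm) endofunctor" where
  "fcomp A F G = \<lparr>FObj = (\<lambda>X \<in> Obj A. FObj F (FObj G X)),
                  FMap = (\<lambda>f \<in> arrows A. FMap F (FMap G f))\<rparr>"

definition nat_trans ::
  "('o, 'm) precat \<Rightarrow> ('o, 'm) endofunctor \<Rightarrow> ('o, 'm) endofunctor \<Rightarrow> ('o \<Rightarrow> 'm) \<Rightarrow> bool" where
  "nat_trans A F G \<alpha> \<longleftrightarrow> \<alpha> \<in> extensional (Obj A) \<and>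
     (\<forall>X \<in> Obj A. \<alpha> X \<in> Hom A (FObj F X) (FObj G X)) \<and>
     (\<forall>X Y f. f \<in> Hom A X Y \<longrightarrow> \<alpha> Y \<cdot>\<^bsub>A\<^esub> FMap F f = FMap G f \<cdot>\<^bsub>A\<^esub> \<alpha> X)"

definition nid :: "('o, 'm) precat \<Rightarrow> ('o, 'm) endofunctor \<Rightarrow> 'o \<Rightarrow> 'm" where
  "nid A F = (\<lambda>X \<in> Obj A. Ident A (FObj F X))"

definition ncomp :: "('o, 'm) precat \<Rightarrow> ('o \<Rightarrow> 'm) \<Rightarrow> ('o \<Rightarrow> 'm) \<Rightarrow> 'o \<Rightarrow> 'm"
    (infixr "\<bullet>\<index>" 75) where
  "ncomp A \<beta> \<alpha> = (\<lambda>X \<in> Obj A. \<beta> X \<cdot>\<^bsub>A\<^esub> \<alpha> X)"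

definition nzero ::
  "('o, 'm) precat \<Rightarrow> ('o, 'm) endofunctor \<Rightarrow> ('o, 'm) endofunctor \<Rightarrow> 'o \<Rightarrow> 'm" where
  "nzero A F G = (\<lambda>X \<in> Obj A. Zero A (FObj F X) (FObj G X))"

definition nadd :: "('o, 'm) precat \<Rightarrow> ('o \<Rightarrow> 'm) \<Rightarrow> ('o \<Rightarrow> 'm) \<Rightarrow> 'o \<Rightarrow> 'm" where
  "nadd A \<alpha> \<beta> = (\<lambda>X \<in> Obj A. \<alpha> X \<oplus>\<^bsub>A\<^esub> \<beta> X)"

definition nneg :: "('o, 'm) precat \<Rightarrow> ('o \<Rightarrow> 'm) \<Rightarrow> 'o \<Rightarrow> 'm" where
  "nneg A \<alpha> = (\<lambda>X \<in> Obj A. Neg A (\<alpha> X))"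

definition ndiff :: "('o, 'm) precat \<Rightarrow> ('o \<Rightarrow> 'm) \<Rightarrow> ('o \<Rightarrow> 'm) \<Rightarrow> 'o \<Rightarrow> 'm" where
  "ndiff A \<alpha> \<beta> = nadd A \<alpha> (nneg A \<beta>)"

text \<open>\<open>at_functor A \<beta> I\<close> is \<open>\<beta>\<^sub>I\<close> and \<open>functor_on A H \<beta>\<close> is \<open>H\<beta>\<close>.\<close>

definition at_functor ::
  "('o, 'm) precat \<Rightarrow> ('o \<Rightarrow> 'm) \<Rightarrow> ('o, 'm) endofunctor \<Rightarrow> 'o \<Rightarrow> 'm" where
  "at_functor A \<beta> I = (\<lambda>Z \<in> Obj A. \<beta> (FObj I Z))"

definition functor_on ::
  "('o, 'm) precat \<Rightarrow> ('o, 'm) endofunctor \<Rightarrow> ('o \<Rightarrow> 'm) \<Rightarrow> 'o \<Rightarrow> 'm" where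
  "functor_on A H \<beta> = (\<lambda>X \<in> Obj A. FMap H (\<beta> X))"


section \<open>Comonads, comodules and bicomodules\<close>

definition comonad ::
  "('o, 'm) precat \<Rightarrow> ('o, 'm) endofunctor \<Rightarrow> ('o \<Rightarrow> 'm) \<Rightarrow> ('o \<Rightarrow> 'm) \<Rightarrow> bool" where
  "comonad A F \<delta> \<xi> \<longleftrightarrow> additive_functor A F \<and>
     nat_trans A F (fcomp A F F) \<delta> \<and> nat_trans A F (id_functor A) \<xi> \<and>
     at_functor A \<delta> F \<bullet>\<^bsub>A\<^esub> \<delta> = functor_on A F \<delta> \<bullet>\<^bsub>A\<^esub> \<delta> \<and>
     functor_on A F \<xi> \<bullet>\<^bsub>A\<^esub> \<delta> = nid A F \<and> at_functor A \<xi> F \<bullet>\<^bsub>A\<^esub> \<delta> = nid A F"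

definition comodule :: "'u itself \<Rightarrow> ('o, 'm) precat \<Rightarrow> ('o, 'm) endofunctor \<Rightarrow> ('o \<Rightarrow> 'm) \<Rightarrow>
    ('o \<Rightarrow> 'm) \<Rightarrow> ('o, 'm) endofunctor \<Rightarrow> ('o \<Rightarrow> 'm) \<Rightarrow> bool" where
  "comodule U A F \<delta> \<xi> M m \<longleftrightarrow> funt U A M \<and> nat_trans A M (fcomp A F M) m \<and>
     at_functor A \<delta> M \<bullet>\<^bsub>A\<^esub> m = functor_on A F m \<bullet>\<^bsub>A\<^esub> m \<and>
     at_functor A \<xi> M \<bullet>\<^bsub>A\<^esub> m = nid A M"

definition comodule_hom :: "('o, 'm) precat \<Rightarrow> ('o, 'm) endofunctor \<Rightarrow>
    ('o, 'm) endofunctor \<Rightarrow> ('o \<Rightarrow> 'm) \<Rightarrow> ('o, 'm) endofunctor \<Rightarrow> ('o \<Rightarrow> 'm) \<Rightarrow> ('o \<Rightarrow> 'm) \<Rightarrow> bool" where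
  "comodule_hom A F M m M' m' f \<longleftrightarrow> nat_trans A M M' f \<and> m' \<bullet>\<^bsub>A\<^esub> f = functor_on A F f \<bullet>\<^bsub>A\<^esub> m"

type_synonym ('o, 'm) bicomod = "('o, 'm) endofunctor \<times> ('o \<Rightarrow> 'm) \<times> ('o \<Rightarrow> 'm)"

fun bicomodule :: "'u itself \<Rightarrow> ('o, 'm) precat \<Rightarrow> ('o, 'm) endofunctor \<Rightarrow> ('o \<Rightarrow> 'm) \<Rightarrow>
    ('o \<Rightarrow> 'm) \<Rightarrow> ('o, 'm) bicomod \<Rightarrow> bool" where
  "bicomodule U A F \<delta> \<xi> (M, m, n) \<longleftrightarrow> comodule U A F \<delta> \<xi> M m \<and> nat_trans A M (fcomp A M F) n \<and>
     functor_on A M \<delta> \<bullet>\<^bsub>A\<^esub> n = at_functor A n F \<bullet>\<^bsub>A\<^esub> n \<and>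
     functor_on A M \<xi> \<bullet>\<^bsub>A\<^esub> n = nid A M \<and>
     at_functor A m F \<bullet>\<^bsub>A\<^esub> n = functor_on A F n \<bullet>\<^bsub>A\<^esub> m"

fun bicomodule_hom :: "('o, 'm) precat \<Rightarrow> ('o, 'm) endofunctor \<Rightarrow>
    ('o, 'm) bicomod \<Rightarrow> ('o, 'm) bicomod \<Rightarrow> ('o \<Rightarrow> 'm) \<Rightarrow> bool" where
  "bicomodule_hom A F (M, m, n) (M', m', n') f \<longleftrightarrow> comodule_hom A F M m M' m' f \<and>
     n' \<bullet>\<^bsub>A\<^esub> f = at_functor A f F \<bullet>\<^bsub>A\<^esub> n"

text \<open>Morphisms of the category of bicomodules carry their source and target, to keep hom-sets
  disjoint.\<close>

definition bicomodule_category :: "'u itself \<Rightarrow> ('o, 'm) precat \<Rightarrow> ('o, 'm) endofunctor \<Rightarrow>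
    ('o \<Rightarrow> 'm) \<Rightarrow> ('o \<Rightarrow> 'm) \<Rightarrow>
    (('o, 'm) bicomod, ('o, 'm) bicomod \<times> ('o \<Rightarrow> 'm) \<times> ('o, 'm) bicomod) precat" where
  "bicomodule_category U A F \<delta> \<xi> =
     \<lparr>Obj = {P. bicomodule U A F \<delta> \<xi> P},
      Hom = (\<lambda>P Q. {(P, f, Q) |f. bicomodule U A F \<delta> \<xi> P \<and> bicomodule U A F \<delta> \<xi> Q \<and>
                                 bicomodule_hom A F P Q f}),
      Ident = (\<lambda>P. (P, nid A (fst P), P)),
      Comp = (\<lambda>(_, g, R) (P, f, _). (P, g \<bullet>\<^bsub>A\<^esub> f, R)),
      Zero = (\<lambda>P Q. (P, nzero A (fst P) (fst Q), Q)),
      Add = (\<lambda>(P, f, Q) (_, g, _). (P, nadd A f g, Q)),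
      Neg = (\<lambda>(P, f, Q). (P, nneg A f, Q))\<rparr>"

text \<open>The bicomodules denoted \<open>F\<close> and \<open>F\<^sup>2\<close>.\<close>

definition bicomod_F :: "('o, 'm) endofunctor \<Rightarrow> ('o \<Rightarrow> 'm) \<Rightarrow> ('o, 'm) bicomod" where
  "bicomod_F F \<delta> = (F, \<delta>, \<delta>)"

definition bicomod_FF ::
  "('o, 'm) precat \<Rightarrow> ('o, 'm) endofunctor \<Rightarrow> ('o \<Rightarrow> 'm) \<Rightarrow> ('o, 'm) bicomod" where
  "bicomod_FF A F \<delta> = (fcomp A F F, at_functor A \<delta> F, functor_on A F \<delta>)"


section \<open>Cointegrations and coderivations\<close>

fun cointegration :: "('o, 'm) precat \<Rightarrow> ('o, 'm) endofunctor \<Rightarrow> ('o \<Rightarrow> 'm) \<Rightarrow>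
    ('o, 'm) bicomod \<Rightarrow> ('o, 'm) bicomod \<Rightarrow> ('o \<Rightarrow> 'm) \<Rightarrow> bool" where
  "cointegration A F \<delta> (M, m, n) (M', m', n') h \<longleftrightarrow> nat_trans A M (fcomp A M' F) h \<and>
     at_functor A m' F \<bullet>\<^bsub>A\<^esub> h = functor_on A F h \<bullet>\<^bsub>A\<^esub> m \<and>
     functor_on A M' \<delta> \<bullet>\<^bsub>A\<^esub> h = nadd A (at_functor A n' F \<bullet>\<^bsub>A\<^esub> h) (at_functor A h F \<bullet>\<^bsub>A\<^esub> n)"

fun inner_cointegration :: "('o, 'm) precat \<Rightarrow> ('o, 'm) endofunctor \<Rightarrow> ('o \<Rightarrow> 'm) \<Rightarrow>
    ('o, 'm) bicomod \<Rightarrow> ('o, 'm) bicomod \<Rightarrow> ('o \<Rightarrow> 'm) \<Rightarrow> bool" where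
  "inner_cointegration A F \<delta> (M, m, n) (M', m', n') h \<longleftrightarrow>
     cointegration A F \<delta> (M, m, n) (M', m', n') h \<and>
     (\<exists>\<phi>. nat_trans A M M' \<phi> \<and> m' \<bullet>\<^bsub>A\<^esub> \<phi> = functor_on A F \<phi> \<bullet>\<^bsub>A\<^esub> m \<and>
        h = ndiff A (at_functor A \<phi> F \<bullet>\<^bsub>A\<^esub> n) (n' \<bullet>\<^bsub>A\<^esub> \<phi>))"

fun coderivation :: "('o, 'm) precat \<Rightarrow> ('o, 'm) endofunctor \<Rightarrow> ('o \<Rightarrow> 'm) \<Rightarrow>
    ('o, 'm) bicomod \<Rightarrow> ('o \<Rightarrow> 'm) \<Rightarrow> bool" where
  "coderivation A F \<delta> (M, m, n) g \<longleftrightarrow> nat_trans A M F g \<and>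
     \<delta> \<bullet>\<^bsub>A\<^esub> g = nadd A (functor_on A F g \<bullet>\<^bsub>A\<^esub> m) (at_functor A g F \<bullet>\<^bsub>A\<^esub> n)"

fun inner_coderivation :: "('o, 'm) precat \<Rightarrow> ('o, 'm) endofunctor \<Rightarrow> ('o \<Rightarrow> 'm) \<Rightarrow>
    ('o, 'm) bicomod \<Rightarrow> ('o \<Rightarrow> 'm) \<Rightarrow> bool" where
  "inner_coderivation A F \<delta> (M, m, n) g \<longleftrightarrow> coderivation A F \<delta> (M, m, n) g \<and>
     (\<exists>l. nat_trans A M (id_functor A) l \<and>
        g = ndiff A (at_functor A l F \<bullet>\<^bsub>A\<^esub> n) (functor_on A F l \<bullet>\<^bsub>A\<^esub> m))"

text \<open>Here \<open>\<delta>c\<close> is the cokernel of \<open>\<delta>\<close> in bicomodules, with target \<open>(K, u, v)\<close>. It is also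
  epimorphic among comodule morphisms, so \<open>w\<close> is determined by this condition.\<close>

definition universal_cointegration :: "('o, 'm) precat \<Rightarrow> ('o, 'm) endofunctor \<Rightarrow> ('o \<Rightarrow> 'm) \<Rightarrow>
    ('o \<Rightarrow> 'm) \<Rightarrow> ('o, 'm) endofunctor \<Rightarrow> ('o \<Rightarrow> 'm) \<Rightarrow> ('o \<Rightarrow> 'm) \<Rightarrow> ('o \<Rightarrow> 'm) \<Rightarrow> bool" where
  "universal_cointegration A F \<delta> \<xi> K u \<delta>c w \<longleftrightarrow>
     comodule_hom A F K u (fcomp A F F) (at_functor A \<delta> F) w \<and>
     w \<bullet>\<^bsub>A\<^esub> \<delta>c = ndiff A (nid A (fcomp A F F)) (\<delta> \<bullet>\<^bsub>A\<^esub> functor_on A F \<xi>)"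

definition universal_coderivation :: "('o, 'm) precat \<Rightarrow> ('o, 'm) endofunctor \<Rightarrow>
    ('o \<Rightarrow> 'm) \<Rightarrow> ('o \<Rightarrow> 'm) \<Rightarrow> 'o \<Rightarrow> 'm" where
  "universal_coderivation A F \<xi> w =
     ndiff A (functor_on A F \<xi> \<bullet>\<^bsub>A\<^esub> w) (at_functor A \<xi> F \<bullet>\<^bsub>A\<^esub> w)"

end

theory Submission
  imports Defs
begin

text \<open>
  The bicomodule \<open>FNF\<close> is cofree on the functor \<open>N\<close>: a natural transformation \<open>f : K \<rightarrow> N\<close> induces a
  bicomodule morphism \<open>F(f\<^sub>F v) u : K \<rightarrow> FNF\<close> from which \<open>f\<close> can be recovered. So
  \<open>\<delta>\<^sup>c\<close>, an epimorphism of bicomodules by hypothesis, can be cancelled in front of arbitrary natural transformations, and every identity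
  about \<open>w\<close> may be checked after composing with \<open>\<delta>\<^sup>c\<close>. This gives \<open>F\<xi> w = 0\<close> and \<open>\<delta>\<^sup>c w = 1\<close>, and it
  makes \<open>\<delta>\<close> the kernel of \<open>\<delta>\<^sup>c\<close>, with \<open>F\<xi> g\<close> the factorisation of \<open>g\<close>. Hence (i) only asks for a
  bicomodule section \<open>s\<close> of \<open>\<delta>\<^sup>c\<close>. Sections correspond to primitives \<open>\<phi>\<close> of \<open>w\<close> by \<open>\<phi> = F\<xi> s\<close> and
  \<open>s = \<phi>\<^sub>F v\<close>, and primitives of \<open>w\<close> to primitives \<open>\<lambda>\<close> of \<open>d = - \<xi>\<^sub>F w\<close> by \<open>\<lambda> = - \<xi> \<phi>\<close> and
  \<open>\<phi> = - F\<lambda> u\<close>, because a left comodule morphism into \<open>F\<^sup>2\<close> is determined by its composite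
  with \<open>\<xi>\<^sub>F\<close>.
\<close>

section \<open>Preadditive categories\<close>

text \<open>Transformations are restrictions to the objects, so this turns an equation between them
  into one equation for each object; most of the \<open>_iff\<close> lemmas below rest on
  it.\<close>

lemma restrict_eq_iff: "restrict f S = restrict g S \<longleftrightarrow> (\<forall>x\<in>S. f x = g x)"
  by (metis restrict_apply' restrict_ext)

context preadditive_category
begin

text \<open>Source and target as functions of the morphism: composability conditions then carry no
  schematic objects, and the simplifier can discharge them.\<close>

definition arr :: "'m \<Rightarrow> bool" where
  "arr f \<longleftrightarrow> (\<exists>X Y. f \<in> Hom C X Y)"

definition dm :: "'m \<Rightarrow> 'o" where
  "dm f = (THE X. \<exists>Y. f \<in> Hom C X Y)"

definition cd :: "'m \<Rightarrow> 'o" where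
  "cd f = (THE Y. \<exists>X. f \<in> Hom C X Y)"

lemma dm_eq: "f \<in> Hom C X Y \<Longrightarrow> dm f = X"
  unfolding dm_def by (rule the_equality) (auto dest: hom_disjoint)

lemma cd_eq: "f \<in> Hom C X Y \<Longrightarrow> cd f = Y"
  unfolding cd_def by (rule the_equality) (auto dest: hom_disjoint)

lemma hom_iff: "f \<in> Hom C X Y \<longleftrightarrow> arr f \<and> dm f = X \<and> cd f = Y"
  unfolding arr_def by (auto simp: dm_eq cd_eq)

lemma arr_hom: "arr f \<Longrightarrow> f \<in> Hom C (dm f) (cd f)"
  by (simp add: hom_iff)

lemma dm_obj [simp]: "arr f \<Longrightarrow> dm f \<in> Obj C" and cd_obj [simp]: "arr f \<Longrightarrow> cd f \<in> Obj C"
  using hom_obj[OF arr_hom] by auto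

lemma arrows_iff: "f \<in> arrows C \<longleftrightarrow> arr f"
  unfolding arrows_def arr_def using hom_obj by blast

lemma arr_ident [simp]:
  assumes "X \<in> Obj C"
  shows "arr (Ident C X)" "dm (Ident C X) = X" "cd (Ident C X) = X"
  using ident_hom[OF assms] by (simp_all add: hom_iff)

lemma arr_comp [simp]:
  assumes "arr f" "arr g" "dm g = cd f"
  shows "arr (g \<cdot> f)" "dm (g \<cdot> f) = dm f" "cd (g \<cdot> f) = cd g"
  using comp_hom[of f "dm f" "cd f" g "cd g"] assms by (simp_all add: hom_iff)

lemma arr_zero [simp]:
  assumes "X \<in> Obj C" "Y \<in> Obj C"
  shows "arr (Zero C X Y)" "dm (Zero C X Y) = X" "cd (Zero C X Y) = Y"
  using zero_hom[OF assms] by (simp_all add: hom_iff)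

lemma arr_add [simp]:
  assumes "arr f" "arr g" "dm f = dm g" "cd f = cd g"
  shows "arr (f \<oplus> g)" "dm (f \<oplus> g) = dm g" "cd (f \<oplus> g) = cd g"
  using add_hom[of f "dm f" "cd f" g] assms by (simp_all add: hom_iff)

lemma arr_neg [simp]:
  assumes "arr f"
  shows "arr (Neg C f)" "dm (Neg C f) = dm f" "cd (Neg C f) = cd f"
  using neg_hom[of f "dm f" "cd f"] assms by (simp_all add: hom_iff)

lemma comp_ident [simp]:
  "arr f \<Longrightarrow> Y = cd f \<Longrightarrow> Ident C Y \<cdot> f = f"
  "arr f \<Longrightarrow> X = dm f \<Longrightarrow> f \<cdot> Ident C X = f"
  by (simp_all add: ident_left[OF arr_hom] ident_right[OF arr_hom])

lemma assoc:
  "\<lbrakk>arr f; arr g; arr h; dm g = cd f; dm h = cd g\<rbrakk> \<Longrightarrow> (h \<cdot> g) \<cdot> f = h \<cdot> g \<cdot> f"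
  by (rule comp_assoc) (simp_all add: hom_iff)

lemma padd_assoc:
  "\<lbrakk>arr f; arr g; arr h; dm f = dm g; dm g = dm h; cd f = cd g; cd g = cd h\<rbrakk>
    \<Longrightarrow> (f \<oplus> g) \<oplus> h = f \<oplus> (g \<oplus> h)"
  by (rule add_assoc) (simp_all add: hom_iff)

lemma padd_commute:
  "\<lbrakk>arr f; arr g; dm f = dm g; cd f = cd g\<rbrakk> \<Longrightarrow> f \<oplus> g = g \<oplus> f"
  by (rule add_commute) (simp_all add: hom_iff)

lemma padd_zero [simp]:
  assumes "arr f" "X = dm f" "Y = cd f"
  shows "f \<oplus> Zero C X Y = f" "Zero C X Y \<oplus> f = f"
proof -
  show *: "f \<oplus> Zero C X Y = f"
    using assms by (intro add_zero) (simp add: hom_iff)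
  show "Zero C X Y \<oplus> f = f"
    by (subst padd_commute) (simp_all add: assms *[unfolded assms])
qed

lemma padd_neg [simp]:
  assumes "arr f"
  shows "f \<oplus> Neg C f = Zero C (dm f) (cd f)" "Neg C f \<oplus> f = Zero C (dm f) (cd f)"
proof -
  show *: "f \<oplus> Neg C f = Zero C (dm f) (cd f)"
    by (rule add_neg[OF arr_hom[OF assms]])
  show "Neg C f \<oplus> f = Zero C (dm f) (cd f)"
    by (subst padd_commute) (simp_all add: assms *)
qed

lemma padd_neg_left [simp]:
  assumes "arr f" "arr g" "dm f = dm g" "cd f = cd g"
  shows "f \<oplus> (Neg C f \<oplus> g) = g" "Neg C f \<oplus> (f \<oplus> g) = g"
    "(g \<oplus> f) \<oplus> Neg C f = g" "(g \<oplus> Neg C f) \<oplus> f = g"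
proof -
  show "f \<oplus> (Neg C f \<oplus> g) = g" "Neg C f \<oplus> (f \<oplus> g) = g"
    by (subst padd_assoc[symmetric]; simp add: assms)+
  show "(g \<oplus> f) \<oplus> Neg C f = g" "(g \<oplus> Neg C f) \<oplus> f = g"
    by (subst padd_assoc; simp add: assms)+
qed

lemma padd_left_cancel:
  assumes "arr f" "arr g" "arr h" "dm f = dm g" "cd f = cd g" "dm f = dm h" "cd f = cd h"
  shows "f \<oplus> g = f \<oplus> h \<longleftrightarrow> g = h"
  using assms by (metis padd_neg_left(2))

lemma neg_unique:
  assumes "arr f" "arr g" "dm f = dm g" "cd f = cd g" "f \<oplus> g = Zero C (dm f) (cd f)"
  shows "Neg C f = g"
  using assms padd_left_cancel[of f "Neg C f" g] by simp

lemma neg_neg [simp]: "arr f \<Longrightarrow> Neg C (Neg C f) = f"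
  by (rule neg_unique) simp_all

lemma diff_eq_zeroD:
  assumes "f \<oplus> Neg C g = Zero C X Y" "arr f" "arr g" "dm f = dm g" "cd f = cd g"
    "X = dm g" "Y = cd g"
  shows "f = g"
  using assms by (metis padd_neg_left(4) padd_zero(2))

lemma neg_diff:
  assumes "arr f" "arr g" "dm f = dm g" "cd f = cd g"
  shows "Neg C (f \<oplus> Neg C g) = g \<oplus> Neg C f"
  by (rule neg_unique) (use assms in \<open>simp_all add: padd_assoc\<close>)

lemma comp_add:
  "\<lbrakk>arr f; arr g; arr h; dm g = dm h; cd g = cd h; dm h = cd f\<rbrakk>
    \<Longrightarrow> (g \<oplus> h) \<cdot> f = g \<cdot> f \<oplus> h \<cdot> f"
  "\<lbrakk>arr f; arr g; arr h; dm f = dm g; cd f = cd g; dm h = cd g\<rbrakk>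
    \<Longrightarrow> h \<cdot> (f \<oplus> g) = h \<cdot> f \<oplus> h \<cdot> g"
   by (rule comp_add_left comp_add_right; simp add: hom_iff)+

text \<open>Cancellation leaves zero as the only idempotent of an abelian group. Preservation of
  zero by composition and by functors is derived from additivity in this way.\<close>

lemma idem_zero:
  assumes "arr f" "f \<oplus> f = f"
  shows "f = Zero C (dm f) (cd f)"
  using assms padd_left_cancel[of f f "Zero C (dm f) (cd f)"] by simp

lemma comp_zero [simp]:
  assumes "arr f"
  shows "Y = cd f \<Longrightarrow> Z \<in> Obj C \<Longrightarrow> Zero C Y Z \<cdot> f = Zero C (dm f) Z"
    and "Y = dm f \<Longrightarrow> Z \<in> Obj C \<Longrightarrow> f \<cdot> Zero C Z Y = Zero C Z (cd f)"
proof -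
  show "Zero C Y Z \<cdot> f = Zero C (dm f) Z" if "Y = cd f" "Z \<in> Obj C"
    using idem_zero[of "Zero C Y Z \<cdot> f"] that assms
    by (simp add: comp_add(1)[symmetric])
  show "f \<cdot> Zero C Z Y = Zero C Z (cd f)" if "Y = dm f" "Z \<in> Obj C"
    using idem_zero[of "f \<cdot> Zero C Z Y"] that assms
    by (simp add: comp_add(2)[symmetric])
qed

lemma comp_neg:
  "\<lbrakk>arr f; arr g; dm g = cd f\<rbrakk> \<Longrightarrow> Neg C g \<cdot> f = Neg C (g \<cdot> f)"
  "\<lbrakk>arr f; arr g; dm g = cd f\<rbrakk> \<Longrightarrow> g \<cdot> Neg C f = Neg C (g \<cdot> f)"
   by (rule neg_unique[symmetric]; simp add: comp_add[symmetric])+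

lemma zero_object_hom_eq:
  assumes "zero_object C N" "arr f" "arr g" "dm f = dm g" "cd f = cd g" "dm g = N \<or> cd g = N"
  shows "f = g"
  using assms arr_hom[of f] arr_hom[of g] unfolding zero_object_def by (metis dm_obj cd_obj)

lemma neg_zero [simp]: "X \<in> Obj C \<Longrightarrow> Y \<in> Obj C \<Longrightarrow> Neg C (Zero C X Y) = Zero C X Y"
  by (rule neg_unique) simp_all

text \<open>Telescoping: after composition with \<open>\<delta>c\<close>, both the cointegration
  identity for \<open>w\<close> and the coderivation identity for \<open>d\<close> take this
  shape.\<close>

lemma diff_add_diff:
  assumes "arr f" "arr g" "arr h" "dm f = dm h" "dm g = dm h" "cd f = cd h" "cd g = cd h"
  shows "(f \<oplus> Neg C g) \<oplus> (g \<oplus> Neg C h) = f \<oplus> Neg C h"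
  by (subst padd_assoc) (simp_all add: assms)

section \<open>Kernels, cokernels and split short sequences\<close>

lemma split_epi_ident: "X \<in> Obj C \<Longrightarrow> split_epi C X X (Ident C X)"
  unfolding split_epi_def by (auto simp: ident_hom intro!: bexI[of _ "Ident C X"])

text \<open>The composite \<open>k \<cdot> h\<close> is annihilated by \<open>f\<close>, so the
  uniqueness clause of the kernel applies to it.\<close>

lemma kernel_monic:
  assumes "kernel C X Y f K k" "arr g" "arr h" "dm g = dm h" "cd g = K" "cd h = K"
    and "k \<cdot> g = k \<cdot> h"
  shows "g = h"
proof -
  have k: "f \<in> Hom C X Y" "k \<in> Hom C K X" "f \<cdot> k = Zero C K Y"
    using assms(1) unfolding kernel_def by auto
  have "f \<cdot> (k \<cdot> h) = (f \<cdot> k) \<cdot> h"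
    using k assms by (subst assoc) (auto simp: hom_iff)
  also have "\<dots> = Zero C (dm h) Y"
    using k assms by (auto simp: hom_iff)
  finally have "f \<cdot> (k \<cdot> h) = Zero C (dm h) Y" .
  moreover have "k \<cdot> h \<in> Hom C (dm h) X"
    using k assms(3,6) by (auto simp: hom_iff)
  ultimately have "\<exists>!l. l \<in> Hom C (dm h) K \<and> k \<cdot> l = k \<cdot> h"
    using assms(1) unfolding kernel_def by blast
  then show ?thesis
    using assms(2-7) by (auto simp: hom_iff)
qed

text \<open>When \<open>i\<close> is a kernel of \<open>j\<close>, the first two pairs split for
  free: \<open>i\<close> has zero kernel, and \<open>X\<close> itself serves as the kernel of
  \<open>j\<close>, with an identity as comparison. The kernel of the map from \<open>Z\<close> to
  zero is \<open>Z\<close>, so the third pair says exactly that \<open>j\<close> has a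
  section.\<close>

lemma split_short_iff_split_epi:
  assumes N: "zero_object C N" and ker: "kernel C Y Z j X i"
  shows "split_short C X Y Z i j \<longleftrightarrow> split_epi C Y Z j"
proof
  have ij: "j \<in> Hom C Y Z" "i \<in> Hom C X Y" "j \<cdot> i = Zero C X Z"
    using ker unfolding kernel_def by auto
  then have ob: "X \<in> Obj C" "Y \<in> Obj C" "Z \<in> Obj C"
    using hom_obj by blast+
  have arr: "arr i" "dm i = X" "cd i = Y" "arr j" "dm j = Y" "cd j = Z"
    using ij by (auto simp: hom_iff)
  {
    assume "split_short C X Y Z i j"
    then obtain N' where "zero_object C N'" "split_pair C Y Z N' j (Zero C Z N')"
      unfolding split_short_def by auto
    then obtain K k l where K: "kernel C Z N' (Zero C Z N') K k" "l \<in> Hom C Y K"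
      "k \<cdot> l = j" "split_epi C Y K l" and N': "N' \<in> Obj C"
      unfolding split_pair_def zero_object_def by auto
    obtain t where t: "t \<in> Hom C K Y" "l \<cdot> t = Ident C K"
      using K(4) unfolding split_epi_def by auto
    have k: "k \<in> Hom C K Z"
      using K(1) unfolding kernel_def by auto
    \<comment> \<open>The zero map out of \<open>Z\<close> kills the identity of \<open>Z\<close>,
      which therefore factors through \<open>k\<close>. This section of \<open>k\<close>, followed
      by \<open>t\<close>, is a section of \<open>j\<close>.\<close>
    obtain h where h: "h \<in> Hom C Z K" "k \<cdot> h = Ident C Z"
      using K(1) ob N' unfolding kernel_def by (metis ident_hom ident_right zero_hom)
    have "j \<cdot> (t \<cdot> h) = k \<cdot> ((l \<cdot> t) \<cdot> h)"
      using K(2) t(1) h(1) k by (simp add: K(3)[symmetric] hom_iff assoc)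
    also have "\<dots> = Ident C Z"
      using t h by (simp add: hom_iff)
    finally show "split_epi C Y Z j"
      unfolding split_epi_def using ij t h by (auto intro!: bexI[of _ "t \<cdot> h"] simp: hom_iff)
  next
    assume j: "split_epi C Y Z j"
    have No: "N \<in> Obj C"
      using N unfolding zero_object_def by auto
    \<comment> \<open>A kernel is monic, so its own kernel is the zero object.\<close>
    have "kernel C X Y i N (Zero C N X)"
      unfolding kernel_def
    proof (intro conjI allI impI)
      fix W g
      assume g: "g \<in> Hom C W X" "i \<cdot> g = Zero C W Y"
      then have g': "arr g" "dm g = W" "cd g = X" and W: "W \<in> Obj C"
        using hom_obj by (auto simp: hom_iff)
      have "g = Zero C W X"
        by (rule kernel_monic[OF ker]) (use g g' W arr ob in simp_all)
      then show "\<exists>!h. h \<in> Hom C W N \<and> Zero C N X \<cdot> h = g"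
        using N W No ob zero_object_hom_eq[OF N]
        by (intro ex1I[of _ "Zero C W N"]) (auto simp: hom_iff)
    qed (use arr ob No in \<open>auto simp: hom_iff\<close>)
    then have 1: "split_pair C N X Y (Zero C N X) i"
      unfolding split_pair_def using ob No arr split_epi_ident[OF No]
      by (intro conjI exI[of _ N] exI[of _ "Zero C N X"] exI[of _ "Ident C N"])
        (auto simp: hom_iff)
    have 2: "split_pair C X Y Z i j"
      unfolding split_pair_def using ij ker arr split_epi_ident[OF ob(1)] ob
      by (intro conjI exI[of _ X] exI[of _ i] exI[of _ "Ident C X"]) (auto simp: hom_iff)
    have "kernel C Z N (Zero C Z N) Z (Ident C Z)"
      unfolding kernel_def using ob No by (auto simp: hom_iff)
    then have 3: "split_pair C Y Z N j (Zero C Z N)"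
      unfolding split_pair_def using ij arr j ob No
      by (intro conjI exI[of _ Z] exI[of _ "Ident C Z"] exI[of _ j]) (auto simp: hom_iff)
    show "split_short C X Y Z i j"
      unfolding split_short_def using N 1 2 3 by blast
  }
qed

lemma cokernel_epic:
  assumes "cokernel C X Y f Q p" "g \<in> Hom C Q Z" "h \<in> Hom C Q Z" "g \<cdot> p = h \<cdot> p"
  shows "g = h"
proof -
  have p: "f \<in> Hom C X Y" "p \<in> Hom C Y Q" "p \<cdot> f = Zero C X Q"
    using assms(1) unfolding cokernel_def by auto
  have "(h \<cdot> p) \<cdot> f = Zero C X Z"
    using p assms(3) hom_obj[OF assms(3)] by (subst assoc) (auto simp: hom_iff)
  moreover have "h \<cdot> p \<in> Hom C Y Z"
    using p assms(3) by (auto simp: hom_iff)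
  ultimately have "\<exists>!l. l \<in> Hom C Q Z \<and> l \<cdot> p = h \<cdot> p"
    using assms(1) unfolding cokernel_def by blast
  then show ?thesis
    using assms(2-4) by blast
qed

section \<open>Functors and natural transformations\<close>

lemma additive_functor_iff:
  "additive_functor C M \<longleftrightarrow>
     FObj M \<in> Obj C \<rightarrow>\<^sub>E Obj C \<and> FMap M \<in> extensional (arrows C) \<and>
     (\<forall>f. arr f \<longrightarrow> arr (FMap M f) \<and> dm (FMap M f) = FObj M (dm f) \<and> cd (FMap M f) = FObj M (cd f)) \<and>
     (\<forall>X \<in> Obj C. FMap M (Ident C X) = Ident C (FObj M X)) \<and>
     (\<forall>f g. arr f \<longrightarrow> arr g \<longrightarrow> cd f = dm g \<longrightarrow> FMap M (g \<cdot> f) = FMap M g \<cdot> FMap M f) \<and>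
     (\<forall>f g. arr f \<longrightarrow> arr g \<longrightarrow> dm f = dm g \<longrightarrow> cd f = cd g \<longrightarrow>
        FMap M (f \<oplus> g) = FMap M f \<oplus> FMap M g)"
  unfolding additive_functor_def hom_iff by auto

lemma functor_obj [simp]: "additive_functor C M \<Longrightarrow> X \<in> Obj C \<Longrightarrow> FObj M X \<in> Obj C"
  unfolding additive_functor_iff by blast

lemma functor_map [simp]:
  assumes "additive_functor C M" "arr f"
  shows "arr (FMap M f)" "dm (FMap M f) = FObj M (dm f)" "cd (FMap M f) = FObj M (cd f)"
  using assms unfolding additive_functor_iff by blast+

lemma functor_simps [simp]:
  assumes "additive_functor C M"
  shows "X \<in> Obj C \<Longrightarrow> FMap M (Ident C X) = Ident C (FObj M X)"
    "\<lbrakk>arr f; arr g; dm g = cd f\<rbrakk> \<Longrightarrow> FMap M (g \<cdot> f) = FMap M g \<cdot> FMap M f"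
    "\<lbrakk>arr f; arr g; dm f = dm g; cd f = cd g\<rbrakk> \<Longrightarrow> FMap M (f \<oplus> g) = FMap M f \<oplus> FMap M g"
  using assms unfolding additive_functor_iff by metis+

lemma functor_zero [simp]:
  assumes "additive_functor C M" "X \<in> Obj C" "Y \<in> Obj C"
  shows "FMap M (Zero C X Y) = Zero C (FObj M X) (FObj M Y)"
  using idem_zero[of "FMap M (Zero C X Y)"] assms by (simp add: functor_simps(3)[symmetric])

lemma functor_neg [simp]:
  assumes "additive_functor C M" "arr f"
  shows "FMap M (Neg C f) = Neg C (FMap M f)"
  by (rule neg_unique[symmetric]) (use assms in \<open>simp_all add: functor_simps(3)[symmetric]\<close>)

lemma fcomp_obj [simp]: "X \<in> Obj C \<Longrightarrow> FObj (fcomp C M N) X = FObj M (FObj N X)"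
  by (simp add: fcomp_def)

lemma fcomp_map [simp]: "arr f \<Longrightarrow> FMap (fcomp C M N) f = FMap M (FMap N f)"
  by (simp add: fcomp_def arrows_iff)

lemma id_functor_simps [simp]:
  "X \<in> Obj C \<Longrightarrow> FObj (id_functor C) X = X" "arr f \<Longrightarrow> FMap (id_functor C) f = f"
  by (simp_all add: id_functor_def arrows_iff)

lemma additive_fcomp [simp]:
  assumes "additive_functor C M" "additive_functor C N"
  shows "additive_functor C (fcomp C M N)"
proof -
  have "FObj (fcomp C M N) \<in> Obj C \<rightarrow>\<^sub>E Obj C" "FMap (fcomp C M N) \<in> extensional (arrows C)"
    using assms by (simp_all add: fcomp_def)
  then show ?thesis
    unfolding additive_functor_iff[of "fcomp C M N"] by (simp add: assms)
qed

lemma preserves_cokernels_fcomp: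
  assumes "preserves_cokernels C M" "preserves_cokernels C N"
  shows "preserves_cokernels C (fcomp C M N)"
  unfolding preserves_cokernels_def
proof (intro allI impI)
  fix X Y f Q p
  assume *: "cokernel C X Y f Q p"
  \<comment> \<open>\<open>fcomp\<close> is the expected composite only on objects and morphisms of
    \<open>C\<close>; these memberships license the rewriting.\<close>
  then have "arr f" "arr p" "X \<in> Obj C" "Y \<in> Obj C" "Q \<in> Obj C"
    unfolding cokernel_def by (auto simp: hom_iff)
  then show "cokernel C (FObj (fcomp C M N) X) (FObj (fcomp C M N) Y) (FMap (fcomp C M N) f)
      (FObj (fcomp C M N) Q) (FMap (fcomp C M N) p)"
    using * assms by (simp add: preserves_cokernels_def)
qed

text \<open>Needed because the values of \<open>fcomp\<close> on \<open>D i\<close> and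
  \<open>\<iota> i\<close> are known only for indices in \<open>I\<close>.\<close>

lemma coproduct_cong:
  assumes "coproduct C I D S \<iota>" "\<And>i. i \<in> I \<Longrightarrow> D i = D' i" "\<And>i. i \<in> I \<Longrightarrow> \<iota> i = \<iota>' i"
  shows "coproduct C I D' S \<iota>'"
  using assms unfolding coproduct_def by simp

lemma commutes_with_direct_sums_fcomp:
  fixes U :: "'u itself"
  assumes "commutes_with_direct_sums U C M" "commutes_with_direct_sums U C N"
  shows "commutes_with_direct_sums U C (fcomp C M N)"
  unfolding commutes_with_direct_sums_def
proof (intro allI impI)
  fix I :: "'u set" and D S \<iota>
  assume I: "small U I" and S: "coproduct C I D S \<iota>"
  have "coproduct C I (\<lambda>i. FObj M (FObj N (D i))) (FObj M (FObj N S)) (\<lambda>i. FMap M (FMap N (\<iota> i)))"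
    using assms I S unfolding commutes_with_direct_sums_def by blast
  moreover have "S \<in> Obj C" "\<And>i. i \<in> I \<Longrightarrow> D i \<in> Obj C" "\<And>i. i \<in> I \<Longrightarrow> arr (\<iota> i)"
    using S unfolding coproduct_def arr_def by (blast dest: hom_obj)+
  ultimately show "coproduct C I (\<lambda>i. FObj (fcomp C M N) (D i)) (FObj (fcomp C M N) S)
      (\<lambda>i. FMap (fcomp C M N) (\<iota> i))"
    by (simp add: coproduct_cong[of _ "\<lambda>i. FObj M (FObj N (D i))" _ "\<lambda>i. FMap M (FMap N (\<iota> i))"])
qed

lemma funt_fcomp [simp]: "funt U C M \<Longrightarrow> funt U C N \<Longrightarrow> funt U C (fcomp C M N)"
  unfolding funt_def
  by (simp add: preserves_cokernels_fcomp commutes_with_direct_sums_fcomp)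

lemma funt_additive [simp]: "funt U C M \<Longrightarrow> additive_functor C M"
  by (simp add: funt_def)

section \<open>Natural transformations, their sums, composites and whiskerings\<close>

lemma nat_trans_iff:
  "nat_trans C M N \<alpha> \<longleftrightarrow> \<alpha> \<in> extensional (Obj C) \<and>
     (\<forall>X\<in>Obj C. arr (\<alpha> X) \<and> dm (\<alpha> X) = FObj M X \<and> cd (\<alpha> X) = FObj N X) \<and>
     (\<forall>f. arr f \<longrightarrow> \<alpha> (cd f) \<cdot> FMap M f = FMap N f \<cdot> \<alpha> (dm f))"
  unfolding nat_trans_def hom_iff by auto

lemma nat_trans_simps:
  assumes "nat_trans C M N \<alpha>" "X \<in> Obj C"
  shows "arr (\<alpha> X)" "dm (\<alpha> X) = FObj M X" "cd (\<alpha> X) = FObj N X"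
  using assms by (auto simp: nat_trans_iff)

lemma naturality:
  "nat_trans C M N \<alpha> \<Longrightarrow> arr f \<Longrightarrow> Y = cd f \<Longrightarrow> \<alpha> Y \<cdot> FMap M f = FMap N f \<cdot> \<alpha> (dm f)"
  by (auto simp: nat_trans_iff)

lemma nat_trans_extensional: "nat_trans C M N \<alpha> \<Longrightarrow> \<alpha> \<in> extensional (Obj C)"
  by (auto simp: nat_trans_iff)

lemma nat_ops [simp]:
  assumes "X \<in> Obj C"
  shows "(\<beta> \<bullet> \<alpha>) X = \<beta> X \<cdot> \<alpha> X" "nid C M X = Ident C (FObj M X)"
    "nzero C M N X = Zero C (FObj M X) (FObj N X)" "nadd C \<alpha> \<beta> X = \<alpha> X \<oplus> \<beta> X"
    "nneg C \<alpha> X = Neg C (\<alpha> X)" "ndiff C \<alpha> \<beta> X = \<alpha> X \<oplus> Neg C (\<beta> X)"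
    "at_functor C \<alpha> N X = \<alpha> (FObj N X)" "functor_on C N \<alpha> X = FMap N (\<alpha> X)"
  using assms by (simp_all add: ncomp_def nid_def nzero_def nadd_def nneg_def ndiff_def
      at_functor_def functor_on_def)

lemma nat_ops_extensional [simp]:
  "\<beta> \<bullet> \<alpha> \<in> extensional (Obj C)" "nid C M \<in> extensional (Obj C)"
  "nzero C M N \<in> extensional (Obj C)" "nadd C \<alpha> \<beta> \<in> extensional (Obj C)"
  "nneg C \<alpha> \<in> extensional (Obj C)" "ndiff C \<alpha> \<beta> \<in> extensional (Obj C)"
  "at_functor C \<alpha> N \<in> extensional (Obj C)" "functor_on C N \<alpha> \<in> extensional (Obj C)"
  by (simp_all add: ncomp_def nid_def nzero_def nadd_def nneg_def ndiff_def
      at_functor_def functor_on_def)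

lemma nat_trans_nid: "additive_functor C M \<Longrightarrow> nat_trans C M M (nid C M)"
  by (simp add: nat_trans_iff)

lemma nat_trans_nzero:
  "additive_functor C M \<Longrightarrow> additive_functor C N \<Longrightarrow> nat_trans C M N (nzero C M N)"
  by (simp add: nat_trans_iff)

lemma nat_trans_ncomp:
  assumes "additive_functor C M" "additive_functor C N" "additive_functor C P"
    and \<alpha>: "nat_trans C M N \<alpha>" and \<beta>: "nat_trans C N P \<beta>"
  shows "nat_trans C M P (\<beta> \<bullet> \<alpha>)"
proof -
  have "(\<beta> (cd f) \<cdot> \<alpha> (cd f)) \<cdot> FMap M f = FMap P f \<cdot> \<beta> (dm f) \<cdot> \<alpha> (dm f)" if "arr f" for f
  proof -
    note [simp] = that assms(1-3) nat_trans_simps[OF \<alpha>] nat_trans_simps[OF \<beta>]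
    have "(\<beta> (cd f) \<cdot> \<alpha> (cd f)) \<cdot> FMap M f = (\<beta> (cd f) \<cdot> FMap N f) \<cdot> \<alpha> (dm f)"
      by (simp add: assoc naturality[OF \<alpha>])
    then show ?thesis
      by (simp add: assoc naturality[OF \<beta>])
  qed
  then show ?thesis
    using assms by (simp add: nat_trans_iff)
qed

lemma nat_trans_nneg:
  assumes "additive_functor C M" "additive_functor C N" "nat_trans C M N \<alpha>"
  shows "nat_trans C M N (nneg C \<alpha>)"
  using assms by (simp add: nat_trans_iff comp_neg)

lemma nat_trans_nadd:
  assumes "additive_functor C M" "additive_functor C N"
    "nat_trans C M N \<alpha>" "nat_trans C M N \<beta>"
  shows "nat_trans C M N (nadd C \<alpha> \<beta>)"
  using assms by (simp add: nat_trans_iff comp_add)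

lemma nat_trans_ndiff:
  assumes "additive_functor C M" "additive_functor C N"
    "nat_trans C M N \<alpha>" "nat_trans C M N \<beta>"
  shows "nat_trans C M N (ndiff C \<alpha> \<beta>)"
  unfolding ndiff_def by (intro nat_trans_nadd nat_trans_nneg assms)

lemma nat_trans_at_functor:
  assumes "additive_functor C H" "nat_trans C M N \<alpha>"
  shows "nat_trans C (fcomp C M H) (fcomp C N H) (at_functor C \<alpha> H)"
proof -
  have "\<alpha> (FObj H (cd f)) \<cdot> FMap M (FMap H f) = FMap N (FMap H f) \<cdot> \<alpha> (FObj H (dm f))"
    if "arr f" for f
    using naturality[OF assms(2), of "FMap H f" "FObj H (cd f)"] that assms(1) by simp
  then show ?thesis
    unfolding nat_trans_iff[of "fcomp C M H"]
    using assms(1) by (simp add: nat_trans_simps[OF assms(2)])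
qed

lemma nat_trans_functor_on:
  assumes H: "additive_functor C H" and M: "additive_functor C M" and N: "additive_functor C N"
    and \<alpha>: "nat_trans C M N \<alpha>"
  shows "nat_trans C (fcomp C H M) (fcomp C H N) (functor_on C H \<alpha>)"
proof -
  have "FMap H (\<alpha> (cd f)) \<cdot> FMap H (FMap M f) = FMap H (FMap N f) \<cdot> FMap H (\<alpha> (dm f))"
    if "arr f" for f
    using that H M N arg_cong[OF naturality[OF \<alpha> that refl], of "FMap H"]
    by (simp add: nat_trans_simps[OF \<alpha>])
  then show ?thesis
    using assms by (simp add: nat_trans_iff nat_trans_simps[OF \<alpha>])
qed

text \<open>Functors are extensional records, so composition is associative on the nose and no
  associators occur. Additivity of the two inner functors ensures that they send objects to objects
  and morphisms to morphisms.\<close>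

lemma fcomp_assoc:
  assumes "additive_functor C N" "additive_functor C P"
  shows "fcomp C (fcomp C M N) P = fcomp C M (fcomp C N P)"
  using assms by (simp add: fcomp_def arrows_iff fun_eq_iff restrict_def)

lemma fcomp_id:
  assumes "additive_functor C M"
  shows "fcomp C M (id_functor C) = M" "fcomp C (id_functor C) M = M"
proof -
  have M: "FObj M \<in> extensional (Obj C)" "FMap M \<in> extensional (arrows C)"
    using assms unfolding additive_functor_iff PiE_def by blast+
  have e: "FObj (fcomp C P Q) \<in> extensional (Obj C)" "FMap (fcomp C P Q) \<in> extensional (arrows C)"
    for P Q by (simp_all add: fcomp_def)
  have "FObj (fcomp C M (id_functor C)) = FObj M" "FObj (fcomp C (id_functor C) M) = FObj M"
    by (rule extensionalityI[OF e(1) M(1)]; simp add: assms)+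
  moreover have "FMap (fcomp C M (id_functor C)) = FMap M" "FMap (fcomp C (id_functor C) M) = FMap M"
    by (rule extensionalityI[OF e(2) M(2)]; simp add: assms arrows_iff)+
  ultimately show "fcomp C M (id_functor C) = M" "fcomp C (id_functor C) M = M"
    by (auto intro: endofunctor.equality)
qed

lemma additive_id_functor [simp]: "additive_functor C (id_functor C)"
proof -
  have "FObj (id_functor C) \<in> Obj C \<rightarrow>\<^sub>E Obj C" "FMap (id_functor C) \<in> extensional (arrows C)"
    by (simp_all add: id_functor_def)
  then show ?thesis
    unfolding additive_functor_iff by simp
qed

definition zero_functor :: "'o \<Rightarrow> ('o, 'm) endofunctor" where
  "zero_functor z = \<lparr>FObj = (\<lambda>X \<in> Obj C. z), FMap = (\<lambda>f \<in> arrows C. Ident C z)\<rparr>"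

lemma zero_functor_simps [simp]:
  "X \<in> Obj C \<Longrightarrow> FObj (zero_functor z) X = z"
  "arr f \<Longrightarrow> FMap (zero_functor z) f = Ident C z"
  by (simp_all add: zero_functor_def arrows_iff)

text \<open>This functor underlies the zero bicomodule that \<open>split_short\<close> asks for.
  Parallel morphisms at \<open>z\<close> agree, so the identity of \<open>z\<close> is its own
  cokernel and \<open>z\<close> is the coproduct of any family of copies of itself.\<close>

lemma funt_zero_functor:
  assumes z: "zero_object C z"
  shows "funt U C (zero_functor z)"
proof -
  have zo [simp]: "z \<in> Obj C"
    using z unfolding zero_object_def by auto
  note eq = zero_object_hom_eq[OF z]
  have "FObj (zero_functor z) \<in> Obj C \<rightarrow>\<^sub>E Obj C" "FMap (zero_functor z) \<in> extensional (arrows C)"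
    by (simp_all add: zero_functor_def)
  then have 1: "additive_functor C (zero_functor z)"
    unfolding additive_functor_iff by (auto intro: eq)
  have ident: "Ident C z = Zero C z z"
    by (rule eq) simp_all
  have "cokernel C z z (Ident C z) z (Ident C z)"
    unfolding cokernel_def by (auto simp: hom_iff ident[symmetric])
  then have 2: "preserves_cokernels C (zero_functor z)"
    unfolding preserves_cokernels_def
  proof (intro allI impI)
    fix X Y f Q p
    assume "cokernel C X Y f Q p"
    then have "arr f" "arr p" "X \<in> Obj C" "Y \<in> Obj C" "Q \<in> Obj C"
      unfolding cokernel_def by (auto simp: hom_iff)
    then show "cokernel C (FObj (zero_functor z) X) (FObj (zero_functor z) Y)
        (FMap (zero_functor z) f) (FObj (zero_functor z) Q) (FMap (zero_functor z) p)"
      using \<open>cokernel C z z (Ident C z) z (Ident C z)\<close> by simp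
  qed
  have 3: "commutes_with_direct_sums U C (zero_functor z)"
    unfolding commutes_with_direct_sums_def
  proof (intro allI impI)
    fix I :: "'u set" and D S \<iota>
    assume S: "coproduct C I D S \<iota>"
    then have *: "S \<in> Obj C" "\<And>i. i \<in> I \<Longrightarrow> D i \<in> Obj C" "\<And>i. i \<in> I \<Longrightarrow> arr (\<iota> i)"
      unfolding coproduct_def arr_def by (blast dest: hom_obj)+
    have "coproduct C I (\<lambda>i. z) z (\<lambda>i. Ident C z)"
      unfolding coproduct_def
    proof (intro conjI ballI allI impI)
      fix Z g
      assume Z: "Z \<in> Obj C" and "\<forall>i\<in>I. g i \<in> Hom C z Z"
      then have "g i = Zero C z Z" if "i \<in> I" for i
        using that by (intro eq) (auto simp: hom_iff)
      with Z show "\<exists>!h. h \<in> Hom C z Z \<and> (\<forall>i\<in>I. h \<cdot> Ident C z = g i)"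
        by (intro ex1I[of _ "Zero C z Z"]) (auto simp: hom_iff intro: eq)
    qed (simp_all add: hom_iff)
    then show "coproduct C I (\<lambda>i. FObj (zero_functor z) (D i)) (FObj (zero_functor z) S)
        (\<lambda>i. FMap (zero_functor z) (\<iota> i))"
      using * by (simp add: coproduct_cong[of _ "\<lambda>i. z" _ "\<lambda>i. Ident C z"])
  qed
  show ?thesis
    unfolding funt_def using 1 2 3 by blast
qed

section \<open>Bicomodules\<close>

text \<open>This and the following pointwise forms reduce each condition on transformations to
  equations in hom-groups, where \<open>assoc\<close>, \<open>comp_add\<close> and naturality
  apply.\<close>

lemma comodule_iff:
  "comodule U C F \<delta> \<xi> M m \<longleftrightarrow> funt U C M \<and> nat_trans C M (fcomp C F M) m \<and>
     (\<forall>X\<in>Obj C. \<delta> (FObj M X) \<cdot> m X = FMap F (m X) \<cdot> m X) \<and>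
     (\<forall>X\<in>Obj C. \<xi> (FObj M X) \<cdot> m X = Ident C (FObj M X))"
  by (simp add: comodule_def ncomp_def at_functor_def functor_on_def nid_def restrict_eq_iff)

lemma comodule_hom_iff:
  "comodule_hom C F M m M' m' f \<longleftrightarrow> nat_trans C M M' f \<and>
     (\<forall>X\<in>Obj C. m' X \<cdot> f X = FMap F (f X) \<cdot> m X)"
  by (simp add: comodule_hom_def ncomp_def functor_on_def restrict_eq_iff)

lemma bicomodule_iff:
  "bicomodule U C F \<delta> \<xi> (M, m, n) \<longleftrightarrow> comodule U C F \<delta> \<xi> M m \<and> nat_trans C M (fcomp C M F) n \<and>
     (\<forall>X\<in>Obj C. FMap M (\<delta> X) \<cdot> n X = n (FObj F X) \<cdot> n X) \<and>
     (\<forall>X\<in>Obj C. FMap M (\<xi> X) \<cdot> n X = Ident C (FObj M X)) \<and>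
     (\<forall>X\<in>Obj C. m (FObj F X) \<cdot> n X = FMap F (n X) \<cdot> m X)"
  by (simp add: ncomp_def at_functor_def functor_on_def nid_def restrict_eq_iff)

lemma bicomodule_hom_iff:
  "bicomodule_hom C F (M, m, n) (M', m', n') f \<longleftrightarrow> nat_trans C M M' f \<and>
     (\<forall>X\<in>Obj C. m' X \<cdot> f X = FMap F (f X) \<cdot> m X) \<and>
     (\<forall>X\<in>Obj C. n' X \<cdot> f X = f (FObj F X) \<cdot> n X)"
  by (simp add: comodule_hom_iff ncomp_def at_functor_def restrict_eq_iff)

lemma cointegration_iff:
  "cointegration C F \<delta> (M, m, n) (M', m', n') h \<longleftrightarrow> nat_trans C M (fcomp C M' F) h \<and>
     (\<forall>X\<in>Obj C. m' (FObj F X) \<cdot> h X = FMap F (h X) \<cdot> m X) \<and>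
     (\<forall>X\<in>Obj C. FMap M' (\<delta> X) \<cdot> h X = n' (FObj F X) \<cdot> h X \<oplus> h (FObj F X) \<cdot> n X)"
  by (simp add: ncomp_def nadd_def at_functor_def functor_on_def restrict_eq_iff)

lemma coderivation_iff:
  "coderivation C F \<delta> (M, m, n) g \<longleftrightarrow> nat_trans C M F g \<and>
     (\<forall>X\<in>Obj C. \<delta> X \<cdot> g X = FMap F (g X) \<cdot> m X \<oplus> g (FObj F X) \<cdot> n X)"
  by (simp add: ncomp_def nadd_def at_functor_def functor_on_def restrict_eq_iff)

declare bicomodule.simps [simp del] bicomodule_hom.simps [simp del]
  cointegration.simps [simp del] coderivation.simps [simp del]

text \<open>Extensionality of \<open>h\<close> makes agreement on objects sufficient; below it comes
  from the naturality contained in being a cointegration or coderivation.\<close>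

lemma eq_ndiff_iff:
  assumes "h \<in> extensional (Obj C)"
  shows "h = ndiff C \<alpha> \<beta> \<longleftrightarrow> (\<forall>X\<in>Obj C. h X = \<alpha> X \<oplus> Neg C (\<beta> X))"
proof
  assume "\<forall>X\<in>Obj C. h X = \<alpha> X \<oplus> Neg C (\<beta> X)"
  then show "h = ndiff C \<alpha> \<beta>"
    by (intro extensionalityI[OF assms nat_ops_extensional(6)]) simp
qed simp

lemma inner_cointegration_iff:
  "inner_cointegration C F \<delta> (M, m, n) (M', m', n') h \<longleftrightarrow>
     cointegration C F \<delta> (M, m, n) (M', m', n') h \<and>
     (\<exists>\<phi>. nat_trans C M M' \<phi> \<and> (\<forall>X\<in>Obj C. m' X \<cdot> \<phi> X = FMap F (\<phi> X) \<cdot> m X) \<and>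
        (\<forall>X\<in>Obj C. h X = \<phi> (FObj F X) \<cdot> n X \<oplus> Neg C (n' X \<cdot> \<phi> X)))"
proof -
  have "h \<in> extensional (Obj C)" if "cointegration C F \<delta> (M, m, n) (M', m', n') h"
    using that unfolding cointegration_iff by (blast intro: nat_trans_extensional)
  then show ?thesis
    unfolding inner_cointegration.simps
    by (auto simp: eq_ndiff_iff ncomp_def functor_on_def at_functor_def restrict_eq_iff)
qed

lemma inner_coderivation_iff:
  "inner_coderivation C F \<delta> (M, m, n) g \<longleftrightarrow> coderivation C F \<delta> (M, m, n) g \<and>
     (\<exists>l. nat_trans C M (id_functor C) l \<and>
        (\<forall>X\<in>Obj C. g X = l (FObj F X) \<cdot> n X \<oplus> Neg C (FMap F (l X) \<cdot> m X)))"
proof -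
  have "g \<in> extensional (Obj C)" if "coderivation C F \<delta> (M, m, n) g"
    using that unfolding coderivation_iff by (blast intro: nat_trans_extensional)
  then show ?thesis
    unfolding inner_coderivation.simps
    by (auto simp: eq_ndiff_iff ncomp_def functor_on_def at_functor_def)
qed

end

section \<open>The comonad and the preadditive category of its bicomodules\<close>

locale comonad_category = preadditive_category C for C :: "('o, 'm) precat" (structure) +
  fixes U :: "'u itself" and F :: "('o, 'm) endofunctor" and \<delta> \<xi> :: "'o \<Rightarrow> 'm"
  assumes comonad: "comonad C F \<delta> \<xi>"
begin

lemma F [simp]: "additive_functor C F"
  using comonad unfolding comonad_def by blast

lemma nat_delta: "nat_trans C F (fcomp C F F) \<delta>" and nat_xi: "nat_trans C F (id_functor C) \<xi>"
  using comonad unfolding comonad_def by blast+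

lemma delta_simps [simp]:
  assumes "X \<in> Obj C"
  shows "arr (\<delta> X)" "dm (\<delta> X) = FObj F X" "cd (\<delta> X) = FObj F (FObj F X)"
  using nat_trans_simps[OF nat_delta assms] assms by simp_all

lemma xi_simps [simp]:
  assumes "X \<in> Obj C"
  shows "arr (\<xi> X)" "dm (\<xi> X) = FObj F X" "cd (\<xi> X) = X"
  using nat_trans_simps[OF nat_xi assms] assms by simp_all

lemma delta_natural: "arr f \<Longrightarrow> Y = cd f \<Longrightarrow> \<delta> Y \<cdot> FMap F f = FMap F (FMap F f) \<cdot> \<delta> (dm f)"
  using naturality[OF nat_delta] by simp

lemma xi_natural: "arr f \<Longrightarrow> Y = cd f \<Longrightarrow> \<xi> Y \<cdot> FMap F f = f \<cdot> \<xi> (dm f)"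
  using naturality[OF nat_xi] by simp

lemma comonad_eqs:
  assumes "X \<in> Obj C"
  shows "\<delta> (FObj F X) \<cdot> \<delta> X = FMap F (\<delta> X) \<cdot> \<delta> X"
    "FMap F (\<xi> X) \<cdot> \<delta> X = Ident C (FObj F X)" "\<xi> (FObj F X) \<cdot> \<delta> X = Ident C (FObj F X)"
proof -
  have "at_functor C \<delta> F \<bullet> \<delta> = functor_on C F \<delta> \<bullet> \<delta>" "functor_on C F \<xi> \<bullet> \<delta> = nid C F"
    "at_functor C \<xi> F \<bullet> \<delta> = nid C F"
    using comonad unfolding comonad_def by blast+
  from this[THEN fun_cong, of X] assms
  show "\<delta> (FObj F X) \<cdot> \<delta> X = FMap F (\<delta> X) \<cdot> \<delta> X"
    "FMap F (\<xi> X) \<cdot> \<delta> X = Ident C (FObj F X)" "\<xi> (FObj F X) \<cdot> \<delta> X = Ident C (FObj F X)"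
    by simp_all
qed

abbreviation "bicomod \<equiv> bicomodule U C F \<delta> \<xi>"
abbreviation "bicomod_hom \<equiv> bicomodule_hom C F"
abbreviation "Bicat \<equiv> bicomodule_category U C F \<delta> \<xi>"

lemma bicomodD:
  assumes "bicomod (M, m, n)"
  shows "additive_functor C M" "nat_trans C M (fcomp C F M) m" "nat_trans C M (fcomp C M F) n"
  using assms unfolding bicomodule_iff comodule_iff funt_def by auto

lemma bicomod_simps:
  assumes P: "bicomod (M, m, n)" and X: "X \<in> Obj C"
  shows "arr (m X)" "dm (m X) = FObj M X" "cd (m X) = FObj F (FObj M X)"
    "arr (n X)" "dm (n X) = FObj M X" "cd (n X) = FObj M (FObj F X)"
  using bicomodD[OF P] X nat_trans_simps[OF bicomodD(2)[OF P] X]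
    nat_trans_simps[OF bicomodD(3)[OF P] X] by simp_all

lemma bicomod_hom_nid: "bicomod P \<Longrightarrow> bicomod_hom P P (nid C (fst P))"
  using bicomodD(1) by (cases P) (auto simp: bicomodule_hom_iff bicomod_simps nat_trans_nid)

lemma bicomod_hom_nzero:
  assumes "bicomod P" "bicomod Q"
  shows "bicomod_hom P Q (nzero C (fst P) (fst Q))"
  using assms bicomodD(1)
  by (cases P; cases Q) (auto simp: bicomodule_hom_iff bicomod_simps nat_trans_nzero)

lemma bicomod_homD: "bicomod_hom P Q f \<Longrightarrow> nat_trans C (fst P) (fst Q) f"
  by (cases P; cases Q) (auto simp: bicomodule_hom_iff)

lemma bicomod_hom_ncomp:
  assumes "bicomod P" "bicomod Q" "bicomod R" "bicomod_hom P Q f" "bicomod_hom Q R g"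
  shows "bicomod_hom P R (g \<bullet> f)"
proof (cases P; cases Q; cases R)
  fix M m n M' m' n' M'' m'' n''
  assume e: "P = (M, m, n)" "Q = (M', m', n')" "R = (M'', m'', n'')"
  note P = assms(1)[unfolded e] and Q = assms(2)[unfolded e] and R = assms(3)[unfolded e]
  note f = assms(4)[unfolded e bicomodule_hom_iff] and g = assms(5)[unfolded e bicomodule_hom_iff]
  note [simp] = bicomodD(1)[OF P] bicomodD(1)[OF Q] bicomodD(1)[OF R]
    bicomod_simps[OF P] bicomod_simps[OF Q] bicomod_simps[OF R]
    nat_trans_simps[OF conjunct1[OF f]] nat_trans_simps[OF conjunct1[OF g]]
  have "m'' X \<cdot> g X \<cdot> f X = (FMap F (g X) \<cdot> FMap F (f X)) \<cdot> m X"
    "n'' X \<cdot> g X \<cdot> f X = (g (FObj F X) \<cdot> f (FObj F X)) \<cdot> n X" if X: "X \<in> Obj C" for X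
  proof -
    have "m'' X \<cdot> g X \<cdot> f X = (FMap F (g X) \<cdot> m' X) \<cdot> f X"
      using g X by (simp add: assoc[symmetric])
    then show "m'' X \<cdot> g X \<cdot> f X = (FMap F (g X) \<cdot> FMap F (f X)) \<cdot> m X"
      using f X by (simp add: assoc)
    have "n'' X \<cdot> g X \<cdot> f X = (g (FObj F X) \<cdot> n' X) \<cdot> f X"
      using g X by (simp add: assoc[symmetric])
    then show "n'' X \<cdot> g X \<cdot> f X = (g (FObj F X) \<cdot> f (FObj F X)) \<cdot> n X"
      using f X by (simp add: assoc)
  qed
  then show ?thesis
    using f g by (simp add: e bicomodule_hom_iff nat_trans_ncomp[of M M' M''])
qed

lemma bicomod_hom_nneg:
  assumes "bicomod P" "bicomod Q" "bicomod_hom P Q f"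
  shows "bicomod_hom P Q (nneg C f)"
proof (cases P; cases Q)
  fix M m n M' m' n'
  assume e: "P = (M, m, n)" "Q = (M', m', n')"
  note P = assms(1)[unfolded e] and Q = assms(2)[unfolded e]
  note f = assms(3)[unfolded e bicomodule_hom_iff]
  note [simp] = bicomodD(1)[OF P] bicomodD(1)[OF Q] bicomod_simps[OF P] bicomod_simps[OF Q]
    nat_trans_simps[OF conjunct1[OF f]]
  show ?thesis
    using f by (simp add: e bicomodule_hom_iff nat_trans_nneg comp_neg)
qed

lemma bicomod_hom_nadd:
  assumes "bicomod P" "bicomod Q" "bicomod_hom P Q f" "bicomod_hom P Q g"
  shows "bicomod_hom P Q (nadd C f g)"
proof (cases P; cases Q)
  fix M m n M' m' n'
  assume e: "P = (M, m, n)" "Q = (M', m', n')"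
  note P = assms(1)[unfolded e] and Q = assms(2)[unfolded e]
  note f = assms(3)[unfolded e bicomodule_hom_iff] and g = assms(4)[unfolded e bicomodule_hom_iff]
  note [simp] = bicomodD(1)[OF P] bicomodD(1)[OF Q] bicomod_simps[OF P] bicomod_simps[OF Q]
    nat_trans_simps[OF conjunct1[OF f]] nat_trans_simps[OF conjunct1[OF g]]
  show ?thesis
    using f g by (simp add: e bicomodule_hom_iff nat_trans_nadd comp_add)
qed

lemma bicat_simps [simp]:
  "P \<in> Obj Bicat \<longleftrightarrow> bicomod P"
  "(P, f, Q) \<in> Hom Bicat P' Q' \<longleftrightarrow>
     P = P' \<and> Q = Q' \<and> bicomod P \<and> bicomod Q \<and> bicomod_hom P Q f"
  "Ident Bicat P = (P, nid C (fst P), P)"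
  "(Q', g, R) \<cdot>\<^bsub>Bicat\<^esub> (P, f, Q) = (P, g \<bullet> f, R)"
  "Zero Bicat P Q = (P, nzero C (fst P) (fst Q), Q)"
  "(P, f, Q) \<oplus>\<^bsub>Bicat\<^esub> (P', f', Q') = (P, nadd C f f', Q)"
  "Neg Bicat (P, f, Q) = (P, nneg C f, Q)"
  by (auto simp: bicomodule_category_def)

lemma bicat_homE:
  assumes "a \<in> Hom Bicat P Q"
  obtains f where "a = (P, f, Q)" "bicomod P" "bicomod Q" "bicomod_hom P Q f"
    "nat_trans C (fst P) (fst Q) f"
  using assms bicomod_homD by (auto simp: bicomodule_category_def)

lemma bicomod_additive: "bicomod P \<Longrightarrow> additive_functor C (fst P)"
  by (cases P) (auto dest: bicomodD)

text \<open>Each axiom is inherited from \<open>C\<close> objectwise, and extensionality lifts it to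
  transformations. The facts on kernels, cokernels and split sequences thereby become available for
  bicomodules.\<close>

sublocale bicat: preadditive_category Bicat
proof
  show "X \<in> Obj Bicat \<and> Y \<in> Obj Bicat" if "f \<in> Hom Bicat X Y" for f X Y
    using that by (auto elim: bicat_homE)
  show "X = X' \<and> Y = Y'" if "f \<in> Hom Bicat X Y" "f \<in> Hom Bicat X' Y'" for f X Y X' Y'
    using that by (auto elim!: bicat_homE)
  show "Ident Bicat X \<in> Hom Bicat X X" if "X \<in> Obj Bicat" for X
    using that by (simp add: bicomod_hom_nid)
  show "Zero Bicat X Y \<in> Hom Bicat X Y" if "X \<in> Obj Bicat" "Y \<in> Obj Bicat" for X Y
    using that by (simp add: bicomod_hom_nzero)
next
  fix f X Y
  assume "f \<in> Hom Bicat X Y"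
  then obtain f' where f: "f = (X, f', Y)" "bicomod X" "bicomod Y" "bicomod_hom X Y f'"
    "nat_trans C (fst X) (fst Y) f'"
    by (rule bicat_homE)
  note [simp] = nat_trans_simps[OF f(5)] bicomod_additive[OF f(2)] bicomod_additive[OF f(3)]
    nat_trans_extensional[OF f(5)] f(1-4)
  show "Ident Bicat Y \<cdot>\<^bsub>Bicat\<^esub> f = f"  "f \<cdot>\<^bsub>Bicat\<^esub> Ident Bicat X = f"
    "f \<oplus>\<^bsub>Bicat\<^esub> Zero Bicat X Y = f" "f \<oplus>\<^bsub>Bicat\<^esub> Neg Bicat f = Zero Bicat X Y"
       by (auto intro!: extensionalityI[of _ "Obj C"])
  show "Neg Bicat f \<in> Hom Bicat X Y"
    by (simp add: bicomod_hom_nneg)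
  fix g
  {
    fix Z assume "g \<in> Hom Bicat Y Z"
    then obtain g' where g: "g = (Y, g', Z)" "bicomod Z" "bicomod_hom Y Z g'"
      "nat_trans C (fst Y) (fst Z) g'"
      by (rule bicat_homE)
    note [simp] = nat_trans_simps[OF g(4)] bicomod_additive[OF g(2)] g(1-3)
    show "g \<cdot>\<^bsub>Bicat\<^esub> f \<in> Hom Bicat X Z"
      by (simp add: bicomod_hom_ncomp[of X Y])
    fix h
    show "(h \<cdot>\<^bsub>Bicat\<^esub> g) \<cdot>\<^bsub>Bicat\<^esub> f = h \<cdot>\<^bsub>Bicat\<^esub> (g \<cdot>\<^bsub>Bicat\<^esub> f)" if "h \<in> Hom Bicat Z W" for W
      using that
      by (auto elim!: bicat_homE intro!: extensionalityI[of _ "Obj C"] simp: assoc nat_trans_simps)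
    assume "h \<in> Hom Bicat Y Z"
    then show "(g \<oplus>\<^bsub>Bicat\<^esub> h) \<cdot>\<^bsub>Bicat\<^esub> f = g \<cdot>\<^bsub>Bicat\<^esub> f \<oplus>\<^bsub>Bicat\<^esub> h \<cdot>\<^bsub>Bicat\<^esub> f"
      by (auto elim!: bicat_homE intro!: extensionalityI[of _ "Obj C"] simp: comp_add nat_trans_simps)
  }
  assume "g \<in> Hom Bicat X Y"
  then obtain g' where g: "g = (X, g', Y)" "bicomod_hom X Y g'" "nat_trans C (fst X) (fst Y) g'"
    by (rule bicat_homE)
  note [simp] = nat_trans_simps[OF g(3)] g(1,2)
  show "f \<oplus>\<^bsub>Bicat\<^esub> g \<in> Hom Bicat X Y"
    by (simp add: bicomod_hom_nadd)
  show "f \<oplus>\<^bsub>Bicat\<^esub> g = g \<oplus>\<^bsub>Bicat\<^esub> f"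
    by (auto intro!: extensionalityI[of _ "Obj C"] simp: padd_commute)
  fix h
  show "(f \<oplus>\<^bsub>Bicat\<^esub> g) \<oplus>\<^bsub>Bicat\<^esub> h = f \<oplus>\<^bsub>Bicat\<^esub> (g \<oplus>\<^bsub>Bicat\<^esub> h)" if "h \<in> Hom Bicat X Y"
    using that
    by (auto elim!: bicat_homE intro!: extensionalityI[of _ "Obj C"] simp: padd_assoc nat_trans_simps)
  show "h \<cdot>\<^bsub>Bicat\<^esub> (f \<oplus>\<^bsub>Bicat\<^esub> g) = h \<cdot>\<^bsub>Bicat\<^esub> f \<oplus>\<^bsub>Bicat\<^esub> h \<cdot>\<^bsub>Bicat\<^esub> g" if "h \<in> Hom Bicat Y Z" for Z
    using that
    by (auto elim!: bicat_homE intro!: extensionalityI[of _ "Obj C"] simp: comp_add nat_trans_simps)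
qed

text \<open>Every comodule equation for the zero functor compares parallel morphisms starting at
  \<open>z\<close>, hence holds; morphisms to and from it are unique at each object, hence
  unique.\<close>

lemma bicat_zero_object:
  assumes z: "zero_object C z"
  shows "\<exists>N. zero_object Bicat N"
proof
  define Z where "Z = zero_functor z"
  define N where "N = (Z, nzero C Z (fcomp C F Z), nzero C Z (fcomp C Z F))"
  have zo [simp]: "z \<in> Obj C"
    using z unfolding zero_object_def by auto
  note eq = zero_object_hom_eq[OF z]
  have Z [simp]: "funt U C Z" "X \<in> Obj C \<Longrightarrow> FObj Z X = z" "arr f \<Longrightarrow> FMap Z f = Ident C z" for X f
    by (simp_all add: Z_def funt_zero_functor[OF z])
  then have [simp]: "additive_functor C Z"
    by (simp only: funt_additive)
  have N: "bicomod N"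
    unfolding N_def bicomodule_iff comodule_iff
    by (auto simp: nat_trans_nzero intro!: eq)
  show "zero_object Bicat N"
    unfolding zero_object_def
  proof (intro conjI ballI)
    fix P assume "P \<in> Obj Bicat"
    then have P: "bicomod P"
      by simp
    show "\<exists>!f. f \<in> Hom Bicat P N"
    proof (rule ex1I)
      show "(P, nzero C (fst P) (fst N), N) \<in> Hom Bicat P N"
        using P N by (simp add: bicomod_hom_nzero)
      fix f assume "f \<in> Hom Bicat P N"
      then show "f = (P, nzero C (fst P) (fst N), N)"
        using bicomod_additive[OF P]
        by (auto elim!: bicat_homE simp: N_def nat_trans_iff intro!: extensionalityI[of _ "Obj C"] eq)
    qed
    show "\<exists>!f. f \<in> Hom Bicat N P"
    proof (rule ex1I)
      show "(N, nzero C (fst N) (fst P), P) \<in> Hom Bicat N P"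
        using P N by (simp add: bicomod_hom_nzero)
      fix f assume "f \<in> Hom Bicat N P"
      then show "f = (N, nzero C (fst N) (fst P), P)"
        using bicomod_additive[OF P]
        by (auto elim!: bicat_homE simp: N_def nat_trans_iff intro!: extensionalityI[of _ "Obj C"] eq)
    qed
  qed (simp add: N)
qed

text \<open>The cofree bicomodule on the functor \<open>N\<close>; for \<open>N\<close> the identity
  functor it is \<open>F\<^sup>2\<close> with its standard coactions.\<close>

definition cofree :: "('o, 'm) endofunctor \<Rightarrow> ('o, 'm) bicomod" where
  "cofree N = (fcomp C F (fcomp C N F), at_functor C \<delta> (fcomp C N F),
     functor_on C F (functor_on C N \<delta>))"

text \<open>The left axioms are those of the comonad at \<open>NF\<close>, the right axioms are the
  comonad equations under \<open>FN\<close>, and the compatibility of the two coactions is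
  naturality of \<open>\<delta>\<close>.\<close>

lemma bicomod_cofree:
  assumes F': "funt U C F" and N: "funt U C N"
  shows "bicomod (cofree N)"
proof -
  have N' [simp]: "additive_functor C N"
    using N by (rule funt_additive)
  have l: "nat_trans C (fcomp C F (fcomp C N F)) (fcomp C F (fcomp C F (fcomp C N F)))
      (at_functor C \<delta> (fcomp C N F))"
    using nat_trans_at_functor[OF _ nat_delta, of "fcomp C N F"] by (simp add: fcomp_assoc)
  have r: "nat_trans C (fcomp C F (fcomp C N F)) (fcomp C (fcomp C F (fcomp C N F)) F)
      (functor_on C F (functor_on C N \<delta>))"
    using nat_trans_functor_on[OF _ _ _ nat_trans_functor_on[OF _ _ _ nat_delta], of F N]
    by (simp add: fcomp_assoc)
  have "FMap F (FMap N (FMap F (\<delta> X))) \<cdot> FMap F (FMap N (\<delta> X))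
      = FMap F (FMap N (\<delta> (FObj F X))) \<cdot> FMap F (FMap N (\<delta> X))"
    "FMap F (FMap N (FMap F (\<xi> X))) \<cdot> FMap F (FMap N (\<delta> X)) = Ident C (FObj F (FObj N (FObj F X)))"
    if "X \<in> Obj C" for X
    using that comonad_eqs(1,2)[OF that, THEN arg_cong, of "\<lambda>f. FMap F (FMap N f)"] by simp_all
  then show ?thesis
    unfolding cofree_def bicomodule_iff comodule_iff
    using l r F' N by (simp add: comonad_eqs delta_natural)
qed

end

section \<open>The cokernel of the comultiplication\<close>

locale comonad_cokernel = comonad_category C U F \<delta> \<xi>
  for C :: "('o, 'm) precat" (structure) and U :: "'u itself" and F \<delta> \<xi> +
  fixes K :: "('o, 'm) endofunctor" and u v \<delta>c :: "'o \<Rightarrow> 'm"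
  assumes coker: "cokernel Bicat (bicomod_F F \<delta>) (bicomod_FF C F \<delta>)
     (bicomod_F F \<delta>, \<delta>, bicomod_FF C F \<delta>) (K, u, v) (bicomod_FF C F \<delta>, \<delta>c, (K, u, v))"
begin

text \<open>Arrows of \<open>Bicat\<close> carry their endpoints, and membership in a hom-set
  includes that the endpoints are bicomodules; all of this is therefore contained in
  \<open>coker\<close>. Membership of \<open>F\<close> and \<open>K\<close> in Funt follows in
  turn.\<close>

lemma bicomod_F: "bicomod (F, \<delta>, \<delta>)"
  and bicomod_K: "bicomod (K, u, v)"
  and bicomod_FF: "bicomod (fcomp C F F, at_functor C \<delta> F, functor_on C F \<delta>)"
  and hom_deltac: "bicomod_hom (fcomp C F F, at_functor C \<delta> F, functor_on C F \<delta>) (K, u, v) \<delta>c"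
  and hom_delta: "bicomod_hom (F, \<delta>, \<delta>) (fcomp C F F, at_functor C \<delta> F, functor_on C F \<delta>) \<delta>"
  using coker unfolding cokernel_def by (simp_all add: bicomod_F_def bicomod_FF_def)

lemma funt_F [simp]: "funt U C F" and funt_K [simp]: "funt U C K"
  using bicomod_F bicomod_K unfolding bicomodule_iff comodule_iff by auto

lemmas K_nat = bicomodD(2,3)[OF bicomod_K]
lemmas [simp] = bicomod_simps[OF bicomod_K] bicomodD(1)[OF bicomod_K]

lemma nat_deltac: "nat_trans C (fcomp C F F) K \<delta>c"
  using hom_deltac unfolding bicomodule_hom_iff by blast

lemma deltac_simps [simp]:
  assumes "X \<in> Obj C"
  shows "arr (\<delta>c X)" "dm (\<delta>c X) = FObj F (FObj F X)" "cd (\<delta>c X) = FObj K X"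
  using nat_trans_simps[OF nat_deltac assms] assms by simp_all

lemma K_eqs:
  assumes "X \<in> Obj C"
  shows "\<delta> (FObj K X) \<cdot> u X = FMap F (u X) \<cdot> u X" "\<xi> (FObj K X) \<cdot> u X = Ident C (FObj K X)"
    "FMap K (\<delta> X) \<cdot> v X = v (FObj F X) \<cdot> v X" "FMap K (\<xi> X) \<cdot> v X = Ident C (FObj K X)"
    "u (FObj F X) \<cdot> v X = FMap F (v X) \<cdot> u X"
  using bicomod_K assms unfolding bicomodule_iff comodule_iff by auto

lemma deltac_eqs:
  assumes "X \<in> Obj C"
  shows "u X \<cdot> \<delta>c X = FMap F (\<delta>c X) \<cdot> \<delta> (FObj F X)"
    "v X \<cdot> \<delta>c X = \<delta>c (FObj F X) \<cdot> FMap F (\<delta> X)"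
    "\<delta>c X \<cdot> \<delta> X = Zero C (FObj F X) (FObj K X)"
proof -
  show "u X \<cdot> \<delta>c X = FMap F (\<delta>c X) \<cdot> \<delta> (FObj F X)" "v X \<cdot> \<delta>c X = \<delta>c (FObj F X) \<cdot> FMap F (\<delta> X)"
    using hom_deltac assms unfolding bicomodule_hom_iff by auto
  have "\<delta>c \<bullet> \<delta> = nzero C F K"
    using coker unfolding cokernel_def by (simp add: bicomod_F_def)
  from fun_cong[OF this, of X] assms show "\<delta>c X \<cdot> \<delta> X = Zero C (FObj F X) (FObj K X)"
    by simp
qed

text \<open>The transpose of \<open>f\<close> under cofreeness, to be read as a map into
  \<open>cofree N\<close>; \<open>N\<close> leaves no trace in the formula, since only components of
  \<open>f\<close> occur.\<close>

definition lift :: "('o \<Rightarrow> 'm) \<Rightarrow> 'o \<Rightarrow> 'm" where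
  "lift f = functor_on C F (at_functor C f F \<bullet> v) \<bullet> u"

lemma lift_apply [simp]: "X \<in> Obj C \<Longrightarrow> lift f X = FMap F (f (FObj F X) \<cdot> v X) \<cdot> u X"
  by (simp add: lift_def)

text \<open>Left colinearity is naturality of \<open>\<delta>\<close> with coassociativity of
  \<open>u\<close>. Right colinearity combines naturality of \<open>f\<close> at
  \<open>\<delta> X\<close>, coassociativity of \<open>v\<close> and the compatibility of
  \<open>u\<close> with \<open>v\<close>.\<close>

lemma bicomod_hom_lift:
  assumes N: "funt U C N" and f: "nat_trans C K N f"
  shows "bicomod_hom (K, u, v) (cofree N) (lift f)"
  unfolding cofree_def bicomodule_hom_iff
proof (intro conjI ballI)
  have N' [simp]: "additive_functor C N"
    using N by (rule funt_additive)
  note [simp] = nat_trans_simps[OF f]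
  have "nat_trans C K (fcomp C N F) (at_functor C f F \<bullet> v)"
    by (rule nat_trans_ncomp[OF _ _ _ K_nat(2) nat_trans_at_functor[OF F f]]) simp_all
  then show "nat_trans C K (fcomp C F (fcomp C N F)) (lift f)"
    unfolding lift_def
    by (intro nat_trans_ncomp[OF _ _ _ K_nat(1) nat_trans_functor_on]) simp_all
  fix X assume X: "X \<in> Obj C"
  let ?g = "f (FObj F X) \<cdot> v X"
  have "\<delta> (FObj N (FObj F X)) \<cdot> FMap F ?g \<cdot> u X = (\<delta> (FObj N (FObj F X)) \<cdot> FMap F ?g) \<cdot> u X"
    using X by (simp add: assoc del: functor_simps(2))
  also have "\<dots> = FMap F (FMap F ?g) \<cdot> \<delta> (FObj K X) \<cdot> u X"
    using X by (simp add: delta_natural assoc del: functor_simps(2))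
  also have "\<dots> = FMap F (FMap F ?g \<cdot> u X) \<cdot> u X"
    using X by (simp add: K_eqs assoc)
  finally show "at_functor C \<delta> (fcomp C N F) X \<cdot> lift f X = FMap F (lift f X) \<cdot> u X"
    using X by simp
  have "FMap N (\<delta> X) \<cdot> ?g = (f (FObj F (FObj F X)) \<cdot> FMap K (\<delta> X)) \<cdot> v X"
    using X naturality[OF f, of "\<delta> X" "FObj F (FObj F X)"] by (simp add: assoc)
  also have "\<dots> = f (FObj F (FObj F X)) \<cdot> v (FObj F X) \<cdot> v X"
    using X by (simp add: assoc K_eqs)
  finally have "FMap F (FMap N (\<delta> X)) \<cdot> FMap F ?g \<cdot> u X
      = FMap F (f (FObj F (FObj F X)) \<cdot> v (FObj F X)) \<cdot> FMap F (v X) \<cdot> u X"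
    using X by (simp add: assoc[symmetric] functor_simps(2)[symmetric] del: functor_simps(2))
  also have "\<dots> = (FMap F (f (FObj F (FObj F X)) \<cdot> v (FObj F X)) \<cdot> u (FObj F X)) \<cdot> v X"
    using X by (simp add: assoc K_eqs)
  finally show "functor_on C F (functor_on C N \<delta>) X \<cdot> lift f X = lift f (FObj F X) \<cdot> v X"
    using X by simp
qed

text \<open>The outer counit moves past \<open>F\<close> by naturality and cancels \<open>u\<close>;
  then \<open>f\<close> is moved past the inner \<open>\<xi> X\<close> by naturality, where the
  counit law cancels \<open>v\<close>.\<close>

lemma lift_recover:
  assumes N: "additive_functor C N" and f: "nat_trans C K N f" and X: "X \<in> Obj C"
  shows "FMap N (\<xi> X) \<cdot> \<xi> (FObj N (FObj F X)) \<cdot> lift f X = f X"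
proof -
  note [simp] = nat_trans_simps[OF f] N X
  let ?g = "f (FObj F X) \<cdot> v X"
  have "\<xi> (FObj N (FObj F X)) \<cdot> FMap F ?g \<cdot> u X = (\<xi> (FObj N (FObj F X)) \<cdot> FMap F ?g) \<cdot> u X"
    by (simp add: assoc del: functor_simps(2))
  also have "\<dots> = ?g"
    by (simp add: xi_natural assoc K_eqs del: functor_simps(2))
  finally have "FMap N (\<xi> X) \<cdot> \<xi> (FObj N (FObj F X)) \<cdot> lift f X = (FMap N (\<xi> X) \<cdot> f (FObj F X)) \<cdot> v X"
    by (simp add: assoc)
  also have "\<dots> = (f X \<cdot> FMap K (\<xi> X)) \<cdot> v X"
    using naturality[OF f, of "\<xi> X" X] by simp
  also have "\<dots> = f X"
    by (simp add: assoc K_eqs)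
  finally show ?thesis .
qed

text \<open>A cokernel in \<open>Bicat\<close> is epic for bicomodule morphisms only. The
  transformations \<open>f\<close> and \<open>g\<close> are replaced by their lifts,
  \<open>\<delta>c\<close> is cancelled there, and \<open>f\<close> and \<open>g\<close> are
  recovered by counits.\<close>

lemma deltac_epic:
  assumes N: "funt U C N" and f: "nat_trans C K N f" and g: "nat_trans C K N g"
    and eq: "\<And>X. X \<in> Obj C \<Longrightarrow> f X \<cdot> \<delta>c X = g X \<cdot> \<delta>c X" and X: "X \<in> Obj C"
  shows "f X = g X"
proof -
  have N' [simp]: "additive_functor C N"
    using N by (rule funt_additive)
  \<comment> \<open>Colinearity of \<open>\<delta>c\<close> on both sides moves it past
    \<open>u\<close> and \<open>v\<close>, so the composite depends on \<open>h\<close> only through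
    \<open>h\<close> after \<open>\<delta>c\<close>.\<close>
  have lift_deltac: "lift h X \<cdot> \<delta>c X
      = FMap F ((h (FObj F X) \<cdot> \<delta>c (FObj F X)) \<cdot> FMap F (\<delta> X)) \<cdot> \<delta> (FObj F X)"
    if h: "nat_trans C K N h" and X: "X \<in> Obj C" for h X
  proof -
    note [simp] = nat_trans_simps[OF h]
    have "lift h X \<cdot> \<delta>c X = FMap F (h (FObj F X) \<cdot> v X) \<cdot> FMap F (\<delta>c X) \<cdot> \<delta> (FObj F X)"
      using X by (simp add: assoc deltac_eqs)
    also have "\<dots> = FMap F (h (FObj F X) \<cdot> v X \<cdot> \<delta>c X) \<cdot> \<delta> (FObj F X)"
      using X by (simp add: assoc)
    finally show ?thesis
      using X by (simp add: deltac_eqs assoc)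
  qed
  have "lift f X \<cdot> \<delta>c X = lift g X \<cdot> \<delta>c X" if "X \<in> Obj C" for X
    using that by (simp only: lift_deltac[OF f] lift_deltac[OF g] eq functor_obj[OF F])
  then have lift_eq: "lift f \<bullet> \<delta>c = lift g \<bullet> \<delta>c"
    unfolding ncomp_def restrict_eq_iff by blast
  \<comment> \<open>Both lifts are arrows of \<open>Bicat\<close>, whose object
    \<open>cofree N\<close> is available because \<open>N\<close> lies in Funt.\<close>
  have "((K, u, v), lift f, cofree N) = ((K, u, v), lift g, cofree N)"
    by (rule bicat.cokernel_epic[OF coker, of _ "cofree N"])
      (simp_all add: lift_eq bicomod_hom_lift[OF N] f g bicomod_K bicomod_cofree N)
  then show ?thesis
    using lift_recover[OF N' f X] lift_recover[OF N' g X] by (simp only: prod.inject)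
qed

end

section \<open>The universal cointegration and coderivation\<close>

locale comonad_universal = comonad_cokernel C U F \<delta> \<xi> K u v \<delta>c
  for C :: "('o, 'm) precat" (structure) and U :: "'u itself" and F \<delta> \<xi> K u v \<delta>c +
  fixes w :: "'o \<Rightarrow> 'm"
  assumes universal: "universal_cointegration C F \<delta> \<xi> K u \<delta>c w"
begin

abbreviation "d \<equiv> universal_coderivation C F \<xi> w"

lemma nat_w: "nat_trans C K (fcomp C F F) w"
  using universal unfolding universal_cointegration_def comodule_hom_def by blast

lemma w_simps [simp]:
  assumes "X \<in> Obj C"
  shows "arr (w X)" "dm (w X) = FObj K X" "cd (w X) = FObj F (FObj F X)"
  using nat_trans_simps[OF nat_w assms] assms by simp_all

lemma w_left: "X \<in> Obj C \<Longrightarrow> \<delta> (FObj F X) \<cdot> w X = FMap F (w X) \<cdot> u X"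
  using universal unfolding universal_cointegration_def comodule_hom_iff by simp

lemma w_deltac:
  assumes "X \<in> Obj C"
  shows "w X \<cdot> \<delta>c X = Ident C (FObj F (FObj F X)) \<oplus> Neg C (\<delta> X \<cdot> FMap F (\<xi> X))"
proof -
  have "w \<bullet> \<delta>c = ndiff C (nid C (fcomp C F F)) (\<delta> \<bullet> functor_on C F \<xi>)"
    using universal unfolding universal_cointegration_def by blast
  from fun_cong[OF this, of X] assms show ?thesis
    by simp
qed

lemma nat_Fxi: "nat_trans C (fcomp C F F) F (functor_on C F \<xi>)"
  using nat_trans_functor_on[OF F F additive_id_functor nat_xi] by (simp add: fcomp_id)

lemma nat_xiF: "nat_trans C (fcomp C F F) F (at_functor C \<xi> F)"
  using nat_trans_at_functor[OF F nat_xi] by (simp add: fcomp_id)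

text \<open>After \<open>\<delta>c\<close> this reads
  \<open>F\<xi> (1 - \<delta> F\<xi>) = 0\<close>, which follows from
  \<open>F\<xi> \<delta> = 1\<close>.\<close>

lemma Fxi_w:
  assumes "X \<in> Obj C"
  shows "FMap F (\<xi> X) \<cdot> w X = Zero C (FObj K X) (FObj F X)"
proof -
  have "(functor_on C F \<xi> \<bullet> w) X = nzero C K F X"
  proof (rule deltac_epic[OF funt_F _ _ _ assms])
    show "nat_trans C K F (functor_on C F \<xi> \<bullet> w)"
      by (rule nat_trans_ncomp[OF _ _ _ nat_w nat_Fxi]) simp_all
    show "nat_trans C K F (nzero C K F)"
      by (simp add: nat_trans_nzero)
    fix X assume X: "X \<in> Obj C"
    have "(FMap F (\<xi> X) \<cdot> \<delta> X) \<cdot> FMap F (\<xi> X) = FMap F (\<xi> X)"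
      using X by (simp add: comonad_eqs)
    then have "FMap F (\<xi> X) \<cdot> \<delta> X \<cdot> FMap F (\<xi> X) = FMap F (\<xi> X)"
      using X by (simp add: assoc)
    then show "(functor_on C F \<xi> \<bullet> w) X \<cdot> \<delta>c X = nzero C K F X \<cdot> \<delta>c X"
      using X by (simp add: assoc w_deltac comp_add comp_neg)
  qed
  then show ?thesis
    using assms by simp
qed

text \<open>After \<open>\<delta>c\<close> this follows from \<open>\<delta>c \<delta> = 0\<close>.
  So \<open>w\<close> splits \<open>\<delta>c\<close> as a left comodule morphism; (i) asks for a
  section that also respects the right coactions.\<close>

lemma deltac_w:
  assumes "X \<in> Obj C"
  shows "\<delta>c X \<cdot> w X = Ident C (FObj K X)"
proof -
  have "(\<delta>c \<bullet> w) X = nid C K X"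
  proof (rule deltac_epic[OF funt_K _ _ _ assms])
    show "nat_trans C K K (\<delta>c \<bullet> w)"
      by (rule nat_trans_ncomp[OF _ _ _ nat_w nat_deltac]) simp_all
    show "nat_trans C K K (nid C K)"
      by (simp add: nat_trans_nid)
    fix X assume X: "X \<in> Obj C"
    have "(\<delta>c X \<cdot> \<delta> X) \<cdot> FMap F (\<xi> X) = Zero C (FObj F (FObj F X)) (FObj K X)"
      using X by (simp add: deltac_eqs)
    then have "\<delta>c X \<cdot> \<delta> X \<cdot> FMap F (\<xi> X) = Zero C (FObj F (FObj F X)) (FObj K X)"
      using X by (simp add: assoc)
    then show "(\<delta>c \<bullet> w) X \<cdot> \<delta>c X = nid C K X \<cdot> \<delta>c X"
      using X by (simp add: assoc w_deltac comp_add comp_neg)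
  qed
  then show ?thesis
    using assms by simp
qed

text \<open>Composed with \<open>\<delta>c\<close>, the two summands on the right become
  \<open>\<delta>\<^sub>F - \<delta>\<^sub>F \<delta> F\<xi>\<close> and
  \<open>F\<delta> - \<delta>\<^sub>F\<close>. Their sum telescopes to
  \<open>F\<delta> - F\<delta> \<delta> F\<xi>\<close> by coassociativity.\<close>

lemma cointegration_w: "cointegration C F \<delta> (K, u, v) (F, \<delta>, \<delta>) w"
  unfolding cointegration_iff
proof (intro conjI ballI)
  fix X assume "X \<in> Obj C"
  let ?f = "functor_on C F \<delta> \<bullet> w"
  let ?g = "nadd C (at_functor C \<delta> F \<bullet> w) (at_functor C w F \<bullet> v)"
  have "?f X = ?g X"
  proof (rule deltac_epic[OF _ _ _ _ \<open>X \<in> Obj C\<close>])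
    show "funt U C (fcomp C F (fcomp C F F))"
      by simp
    show "nat_trans C K (fcomp C F (fcomp C F F)) ?f"
      by (rule nat_trans_ncomp[OF _ _ _ nat_w nat_trans_functor_on[OF _ _ _ nat_delta]]) simp_all
    have "nat_trans C (fcomp C F F) (fcomp C F (fcomp C F F)) (at_functor C \<delta> F)"
      "nat_trans C (fcomp C K F) (fcomp C F (fcomp C F F)) (at_functor C w F)"
      using nat_trans_at_functor[OF F nat_delta] nat_trans_at_functor[OF F nat_w]
      by (simp_all add: fcomp_assoc)
    then show "nat_trans C K (fcomp C F (fcomp C F F)) ?g"
      by (intro nat_trans_nadd nat_trans_ncomp[OF _ _ _ nat_w] nat_trans_ncomp[OF _ _ _ K_nat(2)])
        simp_all
    fix X assume X: "X \<in> Obj C"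
    let ?FX = "FObj F X"
    have "(FMap F (\<delta> X) \<cdot> \<delta> X) \<cdot> FMap F (\<xi> X) = (\<delta> ?FX \<cdot> \<delta> X) \<cdot> FMap F (\<xi> X)"
      using X by (simp add: comonad_eqs)
    then have 1: "FMap F (\<delta> X) \<cdot> \<delta> X \<cdot> FMap F (\<xi> X) = \<delta> ?FX \<cdot> \<delta> X \<cdot> FMap F (\<xi> X)"
      using X by (simp add: assoc)
    have Fxi_Fdelta: "FMap F (\<xi> ?FX) \<cdot> FMap F (\<delta> X) = Ident C (FObj F ?FX)"
      using X comonad_eqs(3)[OF X, THEN arg_cong, of "FMap F"] by simp
    have "(w ?FX \<cdot> v X) \<cdot> \<delta>c X = (w ?FX \<cdot> \<delta>c ?FX) \<cdot> FMap F (\<delta> X)"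
      using X by (simp add: assoc deltac_eqs)
    also have "\<dots> = FMap F (\<delta> X) \<oplus> Neg C (\<delta> ?FX)"
      using X by (simp add: w_deltac comp_add comp_neg assoc Fxi_Fdelta)
    finally have 2: "(w ?FX \<cdot> v X) \<cdot> \<delta>c X = FMap F (\<delta> X) \<oplus> Neg C (\<delta> ?FX)" .
    have "?g X \<cdot> \<delta>c X = (\<delta> ?FX \<oplus> Neg C (\<delta> ?FX \<cdot> \<delta> X \<cdot> FMap F (\<xi> X)))
        \<oplus> (FMap F (\<delta> X) \<oplus> Neg C (\<delta> ?FX))"
      \<comment> \<open>Fact \<open>2\<close> is applied first, since \<open>assoc\<close> would
        rebracket the left-hand side that it matches.\<close>
      using X by (simp add: comp_add 2) (simp add: assoc w_deltac comp_add comp_neg)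
    \<comment> \<open>The summands are swapped to bring the cancelling copies of
      \<open>\<delta> ?FX\<close> into the position that \<open>diff_add_diff\<close>
      expects.\<close>
    also have "\<dots> = (FMap F (\<delta> X) \<oplus> Neg C (\<delta> ?FX))
        \<oplus> (\<delta> ?FX \<oplus> Neg C (\<delta> ?FX \<cdot> \<delta> X \<cdot> FMap F (\<xi> X)))"
      using X by (intro padd_commute) simp_all
    also have "\<dots> = FMap F (\<delta> X) \<oplus> Neg C (\<delta> ?FX \<cdot> \<delta> X \<cdot> FMap F (\<xi> X))"
      using X by (intro diff_add_diff) simp_all
    also have "\<dots> = ?f X \<cdot> \<delta>c X"
      using X by (simp add: assoc w_deltac comp_add comp_neg 1)
    finally show "?f X \<cdot> \<delta>c X = ?g X \<cdot> \<delta>c X" ..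
  qed
  then show "FMap F (\<delta> X) \<cdot> w X = \<delta> (FObj F X) \<cdot> w X \<oplus> w (FObj F X) \<cdot> v X"
    using \<open>X \<in> Obj C\<close> by simp
qed (simp_all add: nat_w w_left)

lemma nat_d: "nat_trans C K F d"
  unfolding universal_coderivation_def
  by (intro nat_trans_ndiff nat_trans_ncomp[OF _ _ _ nat_w] nat_Fxi nat_xiF) simp_all

text \<open>The other term in the definition of \<open>d\<close> vanishes by
  \<open>Fxi_w\<close>.\<close>

lemma d_eq:
  assumes "X \<in> Obj C"
  shows "d X = Neg C (\<xi> (FObj F X) \<cdot> w X)"
  using assms by (simp add: universal_coderivation_def Fxi_w)

lemma d_simps [simp]:
  assumes "X \<in> Obj C"
  shows "arr (d X)" "dm (d X) = FObj K X" "cd (d X) = FObj F X"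
  using nat_trans_simps[OF nat_d assms] assms by simp_all

lemma d_deltac:
  assumes X: "X \<in> Obj C"
  shows "d X \<cdot> \<delta>c X = FMap F (\<xi> X) \<oplus> Neg C (\<xi> (FObj F X))"
proof -
  have "(\<xi> (FObj F X) \<cdot> \<delta> X) \<cdot> FMap F (\<xi> X) = FMap F (\<xi> X)"
    using X by (simp add: comonad_eqs)
  then have "\<xi> (FObj F X) \<cdot> \<delta> X \<cdot> FMap F (\<xi> X) = FMap F (\<xi> X)"
    using X by (simp add: assoc)
  then show ?thesis
    using X by (simp add: d_eq comp_neg assoc w_deltac comp_add neg_diff)
qed

text \<open>Composed with \<open>\<delta>c\<close>, the right-hand side becomes
  \<open>(\<delta> F\<xi> - 1) + (1 - \<delta> \<xi>\<^sub>F)\<close>, which telescopes to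
  \<open>\<delta> (F\<xi> - \<xi>\<^sub>F)\<close>.\<close>

lemma coderivation_d: "coderivation C F \<delta> (K, u, v) d"
  unfolding coderivation_iff
proof (intro conjI ballI)
  fix X assume "X \<in> Obj C"
  let ?f = "\<delta> \<bullet> d"
  let ?g = "nadd C (functor_on C F d \<bullet> u) (at_functor C d F \<bullet> v)"
  have "?f X = ?g X"
  proof (rule deltac_epic[OF _ _ _ _ \<open>X \<in> Obj C\<close>])
    show "funt U C (fcomp C F F)"
      by simp
    show "nat_trans C K (fcomp C F F) ?f"
      by (rule nat_trans_ncomp[OF _ _ _ nat_d nat_delta]) simp_all
    show "nat_trans C K (fcomp C F F) ?g"
      by (intro nat_trans_nadd nat_trans_ncomp[OF _ _ _ K_nat(1) nat_trans_functor_on]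
          nat_trans_ncomp[OF _ _ _ K_nat(2) nat_trans_at_functor] nat_d) simp_all
    fix X assume X: "X \<in> Obj C"
    let ?FX = "FObj F X"
    \<comment> \<open>Left colinearity of \<open>\<delta>c\<close> exposes \<open>d\<close> after
      \<open>\<delta>c\<close> under \<open>F\<close>; right colinearity does the same for the other
      summand below.\<close>
    have "(FMap F (d X) \<cdot> u X) \<cdot> \<delta>c X = FMap F (d X \<cdot> \<delta>c X) \<cdot> \<delta> ?FX"
      using X by (simp add: assoc deltac_eqs)
    also have "\<dots> = \<delta> X \<cdot> FMap F (\<xi> X) \<oplus> Neg C (Ident C (FObj F ?FX))"
      using X by (simp add: d_deltac comp_add comp_neg comonad_eqs delta_natural)
    finally have 1: "(FMap F (d X) \<cdot> u X) \<cdot> \<delta>c X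
      = \<delta> X \<cdot> FMap F (\<xi> X) \<oplus> Neg C (Ident C (FObj F ?FX))" .
    have Fxi_Fdelta: "FMap F (\<xi> ?FX) \<cdot> FMap F (\<delta> X) = Ident C (FObj F ?FX)"
      using X comonad_eqs(3)[OF X, THEN arg_cong, of "FMap F"] by simp
    have "(d ?FX \<cdot> v X) \<cdot> \<delta>c X = (d ?FX \<cdot> \<delta>c ?FX) \<cdot> FMap F (\<delta> X)"
      using X by (simp add: assoc deltac_eqs)
    also have "\<dots> = Ident C (FObj F ?FX) \<oplus> Neg C (\<delta> X \<cdot> \<xi> ?FX)"
      using X by (simp add: d_deltac comp_add comp_neg Fxi_Fdelta xi_natural)
    finally have 2: "(d ?FX \<cdot> v X) \<cdot> \<delta>c X = Ident C (FObj F ?FX) \<oplus> Neg C (\<delta> X \<cdot> \<xi> ?FX)" .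
    have "?g X \<cdot> \<delta>c X = (\<delta> X \<cdot> FMap F (\<xi> X) \<oplus> Neg C (Ident C (FObj F ?FX)))
        \<oplus> (Ident C (FObj F ?FX) \<oplus> Neg C (\<delta> X \<cdot> \<xi> ?FX))"
      using X by (simp add: comp_add 1 2)
    also have "\<dots> = \<delta> X \<cdot> FMap F (\<xi> X) \<oplus> Neg C (\<delta> X \<cdot> \<xi> ?FX)"
      using X by (intro diff_add_diff) simp_all
    also have "\<dots> = ?f X \<cdot> \<delta>c X"
      using X by (simp add: assoc d_deltac comp_add comp_neg)
    finally show "?f X \<cdot> \<delta>c X = ?g X \<cdot> \<delta>c X" ..
  qed
  then show "\<delta> X \<cdot> d X = FMap F (d X) \<cdot> u X \<oplus> d (FObj F X) \<cdot> v X"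
    using \<open>X \<in> Obj C\<close> by simp
qed (rule nat_d)

section \<open>The comultiplication as kernel of its cokernel\<close>

lemma delta_monic:
  assumes "arr f" "arr g" "X \<in> Obj C" "cd f = FObj F X" "cd g = FObj F X" "\<delta> X \<cdot> f = \<delta> X \<cdot> g"
  shows "f = g"
proof -
  have "(FMap F (\<xi> X) \<cdot> \<delta> X) \<cdot> f = (FMap F (\<xi> X) \<cdot> \<delta> X) \<cdot> g"
    using assms by (simp add: assoc del: functor_simps)
  then show ?thesis
    using assms by (simp add: comonad_eqs)
qed

text \<open>If \<open>\<delta>c g = 0\<close>, then
  \<open>0 = w \<delta>c g = g - \<delta> F\<xi> g\<close>, so \<open>F\<xi> g\<close> factors
  \<open>g\<close> through \<open>\<delta>\<close>. It remains to check that this factor is a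
  bicomodule morphism; uniqueness holds because \<open>F\<xi>\<close> retracts
  \<open>\<delta>\<close>.\<close>

lemma kernel_deltac:
  "kernel Bicat (bicomod_FF C F \<delta>) (K, u, v) (bicomod_FF C F \<delta>, \<delta>c, (K, u, v))
     (bicomod_F F \<delta>) (bicomod_F F \<delta>, \<delta>, bicomod_FF C F \<delta>)"
  unfolding kernel_def
proof (intro conjI allI impI)
  fix W a
  assume a: "a \<in> Hom Bicat W (bicomod_FF C F \<delta>)"
    "(bicomod_FF C F \<delta>, \<delta>c, (K, u, v)) \<cdot>\<^bsub>Bicat\<^esub> a = Zero Bicat W (K, u, v)"
  obtain M m n where W: "W = (M, m, n)"
    by (cases W)
  obtain g where a_eq: "a = (W, g, bicomod_FF C F \<delta>)" and M: "bicomod (M, m, n)"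
    and g: "bicomod_hom (M, m, n) (fcomp C F F, at_functor C \<delta> F, functor_on C F \<delta>) g"
    using a(1) by (auto simp: W bicomod_FF_def elim: bicat_homE)
  have nat_g: "nat_trans C M (fcomp C F F) g"
    using g unfolding bicomodule_hom_iff by blast
  have g_simps [simp]: "arr (g X)" "dm (g X) = FObj M X" "cd (g X) = FObj F (FObj F X)"
    if "X \<in> Obj C" for X
    using nat_trans_simps[OF nat_g that] that by simp_all
  note [simp] = bicomod_simps[OF M] bicomodD(1)[OF M]
  have g_eqs: "\<delta> (FObj F X) \<cdot> g X = FMap F (g X) \<cdot> m X"
    "FMap F (\<delta> X) \<cdot> g X = g (FObj F X) \<cdot> n X" if "X \<in> Obj C" for X
    using g that unfolding bicomodule_hom_iff by auto
  have deltac_comp_g: "\<delta>c \<bullet> g = nzero C M K"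
    using a(2) by (simp add: a_eq W)
  have deltac_g: "\<delta>c X \<cdot> g X = Zero C (FObj M X) (FObj K X)" if "X \<in> Obj C" for X
    using that fun_cong[OF deltac_comp_g, of X] by simp
  have delta_h: "\<delta> X \<cdot> FMap F (\<xi> X) \<cdot> g X = g X" if X: "X \<in> Obj C" for X
  proof -
    have "g X \<oplus> Neg C (\<delta> X \<cdot> FMap F (\<xi> X) \<cdot> g X) = (w X \<cdot> \<delta>c X) \<cdot> g X"
      using X by (simp add: w_deltac comp_add comp_neg assoc)
    also have "\<dots> = w X \<cdot> (\<delta>c X \<cdot> g X)"
      using X by (simp add: assoc)
    also have "\<dots> = Zero C (FObj M X) (FObj F (FObj F X))"
      using X by (simp add: deltac_g)
    finally show ?thesis
      by (rule diff_eq_zeroD[symmetric]) (use X in simp_all)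
  qed
  define h where "h = functor_on C F \<xi> \<bullet> g"
  have h [simp]: "h X = FMap F (\<xi> X) \<cdot> g X" if "X \<in> Obj C" for X
    using that by (simp add: h_def)
  have "bicomod_hom (M, m, n) (F, \<delta>, \<delta>) h"
    unfolding bicomodule_hom_iff
  proof (intro conjI ballI)
    show "nat_trans C M F h"
      unfolding h_def by (rule nat_trans_ncomp[OF _ _ _ nat_g nat_Fxi]) simp_all
    fix X assume X: "X \<in> Obj C"
    have "FMap F (h X) \<cdot> m X = FMap F (FMap F (\<xi> X)) \<cdot> \<delta> (FObj F X) \<cdot> g X"
      using X by (simp add: g_eqs assoc)
    also have "\<dots> = (\<delta> X \<cdot> FMap F (\<xi> X)) \<cdot> g X"
      using X by (simp add: delta_natural assoc[symmetric])
    finally show "\<delta> X \<cdot> h X = FMap F (h X) \<cdot> m X"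
      using X by (simp add: assoc)
    \<comment> \<open>Right colinearity of \<open>g\<close> brings in \<open>F\<delta>\<close>,
      which \<open>F\<xi>\<^sub>F\<close> cancels. The result is \<open>g\<close> itself, and
      \<open>delta_h\<close> identifies it with \<open>\<delta> h\<close>.\<close>
    have "h (FObj F X) \<cdot> n X = FMap F (\<xi> (FObj F X)) \<cdot> FMap F (\<delta> X) \<cdot> g X"
      using X by (simp add: g_eqs assoc)
    also have "\<dots> = FMap F (\<xi> (FObj F X) \<cdot> \<delta> X) \<cdot> g X"
      using X by (simp add: assoc)
    \<comment> \<open>The counit law is used before the simplifier can distribute \<open>F\<close>
      over the composite.\<close>
    also have "\<dots> = g X"
      using X by (simp only: comonad_eqs) simp
    finally show "\<delta> X \<cdot> h X = h (FObj F X) \<cdot> n X"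
      using X by (simp add: delta_h)
  qed
  then have h_hom: "(W, h, bicomod_F F \<delta>) \<in> Hom Bicat W (bicomod_F F \<delta>)"
    using M bicomod_F by (simp add: W bicomod_F_def)
  have "\<delta> \<bullet> h = g"
    by (rule extensionalityI[OF _ nat_trans_extensional[OF nat_g]]) (simp_all add: delta_h)
  then have eq: "(bicomod_F F \<delta>, \<delta>, bicomod_FF C F \<delta>) \<cdot>\<^bsub>Bicat\<^esub> (W, h, bicomod_F F \<delta>) = a"
    by (simp add: a_eq)
  show "\<exists>!b. b \<in> Hom Bicat W (bicomod_F F \<delta>)
      \<and> (bicomod_F F \<delta>, \<delta>, bicomod_FF C F \<delta>) \<cdot>\<^bsub>Bicat\<^esub> b = a"
  proof (rule ex1I, rule conjI[OF h_hom eq])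
    fix b
    assume b: "b \<in> Hom Bicat W (bicomod_F F \<delta>)
      \<and> (bicomod_F F \<delta>, \<delta>, bicomod_FF C F \<delta>) \<cdot>\<^bsub>Bicat\<^esub> b = a"
    then obtain k where k: "b = (W, k, bicomod_F F \<delta>)" "nat_trans C M F k"
      by (auto simp: W bicomod_F_def elim: bicat_homE)
    have "\<delta> \<bullet> k = \<delta> \<bullet> h"
      using b eq by (auto simp: k)
    then have delta_k: "\<delta> X \<cdot> k X = \<delta> X \<cdot> h X" if "X \<in> Obj C" for X
      using that unfolding ncomp_def restrict_eq_iff by blast
    have "k X = h X" if "X \<in> Obj C" for X
      by (rule delta_monic[OF _ _ that _ _ delta_k[OF that]])
        (use that in \<open>simp_all add: nat_trans_simps[OF k(2)]\<close>)
    then have "k = h"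
      by (rule extensionalityI[OF nat_trans_extensional[OF k(2)], rotated]) (simp_all add: h_def)
    then show "b = (W, h, bicomod_F F \<delta>)"
      by (simp add: k)
  qed
next
  show "(bicomod_FF C F \<delta>, \<delta>c, (K, u, v)) \<cdot>\<^bsub>Bicat\<^esub> (bicomod_F F \<delta>, \<delta>, bicomod_FF C F \<delta>)
      = Zero Bicat (bicomod_F F \<delta>) (K, u, v)"
    using coker unfolding cokernel_def by blast
qed (use bicomod_F bicomod_K bicomod_FF hom_delta hom_deltac in
    \<open>simp_all add: bicomod_F_def bicomod_FF_def\<close>)

section \<open>The two equivalences\<close>

lemma split_epi_deltac_iff:
  "split_epi Bicat (bicomod_FF C F \<delta>) (K, u, v) (bicomod_FF C F \<delta>, \<delta>c, (K, u, v)) \<longleftrightarrow>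
     (\<exists>s. bicomod_hom (K, u, v) (fcomp C F F, at_functor C \<delta> F, functor_on C F \<delta>) s \<and>
        (\<forall>X\<in>Obj C. \<delta>c X \<cdot> s X = Ident C (FObj K X)))"
proof -
  have "\<delta>c \<bullet> s = nid C K \<longleftrightarrow> (\<forall>X\<in>Obj C. \<delta>c X \<cdot> s X = Ident C (FObj K X))" for s
    by (simp add: ncomp_def nid_def restrict_eq_iff)
  then show ?thesis
    unfolding split_epi_def using bicomod_K bicomod_FF hom_deltac
    by (fastforce simp: bicomod_FF_def elim!: bicat_homE
        intro!: bexI[of _ "((K, u, v), s, bicomod_FF C F \<delta>)" for s])
qed

text \<open>A section \<open>s\<close> differs from \<open>w\<close> by a map through
  \<open>\<delta>\<close>: \<open>s - w = \<delta> \<phi>\<close> with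
  \<open>\<phi> = F\<xi> s\<close>. Right colinearity of \<open>s\<close> gives
  \<open>s = \<phi>\<^sub>F v\<close>, so this difference formula is precisely the inner
  condition.\<close>

lemma inner_w_iff_split_epi:
  "inner_cointegration C F \<delta> (K, u, v) (bicomod_F F \<delta>) w \<longleftrightarrow>
     split_epi Bicat (bicomod_FF C F \<delta>) (K, u, v) (bicomod_FF C F \<delta>, \<delta>c, (K, u, v))"
  unfolding split_epi_deltac_iff bicomod_F_def inner_cointegration_iff
proof (intro iffI conjI cointegration_w)
  assume "\<exists>s. bicomod_hom (K, u, v) (fcomp C F F, at_functor C \<delta> F, functor_on C F \<delta>) s \<and>
    (\<forall>X\<in>Obj C. \<delta>c X \<cdot> s X = Ident C (FObj K X))"
  then obtain s where nat_s: "nat_trans C K (fcomp C F F) s"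
    and s_eqs: "\<And>X. X \<in> Obj C \<Longrightarrow> \<delta> (FObj F X) \<cdot> s X = FMap F (s X) \<cdot> u X"
      "\<And>X. X \<in> Obj C \<Longrightarrow> FMap F (\<delta> X) \<cdot> s X = s (FObj F X) \<cdot> v X"
      "\<And>X. X \<in> Obj C \<Longrightarrow> \<delta>c X \<cdot> s X = Ident C (FObj K X)"
    unfolding bicomodule_hom_iff by auto
  have [simp]: "arr (s X)" "dm (s X) = FObj K X" "cd (s X) = FObj F (FObj F X)"
    if "X \<in> Obj C" for X
    using nat_trans_simps[OF nat_s that] that by simp_all
  define \<phi> where "\<phi> = functor_on C F \<xi> \<bullet> s"
  have \<phi>: "\<phi> X = FMap F (\<xi> X) \<cdot> s X" if "X \<in> Obj C" for X
    using that by (simp add: \<phi>_def)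
  show "\<exists>\<phi>. nat_trans C K F \<phi> \<and> (\<forall>X\<in>Obj C. \<delta> X \<cdot> \<phi> X = FMap F (\<phi> X) \<cdot> u X) \<and>
     (\<forall>X\<in>Obj C. w X = \<phi> (FObj F X) \<cdot> v X \<oplus> Neg C (\<delta> X \<cdot> \<phi> X))"
  proof (intro exI conjI ballI)
    show "nat_trans C K F \<phi>"
      unfolding \<phi>_def by (rule nat_trans_ncomp[OF _ _ _ nat_s nat_Fxi]) simp_all
    fix X assume X: "X \<in> Obj C"
    have "FMap F (\<phi> X) \<cdot> u X = FMap F (FMap F (\<xi> X)) \<cdot> \<delta> (FObj F X) \<cdot> s X"
      using X by (simp add: \<phi> s_eqs assoc)
    also have "\<dots> = (\<delta> X \<cdot> FMap F (\<xi> X)) \<cdot> s X"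
      using X by (simp add: delta_natural assoc[symmetric])
    finally show "\<delta> X \<cdot> \<phi> X = FMap F (\<phi> X) \<cdot> u X"
      using X by (simp add: \<phi> assoc)
    \<comment> \<open>Right colinearity of \<open>s\<close> trades \<open>v\<close> for
      \<open>F\<delta>\<close>, so that \<open>s\<close> is recovered from
      \<open>\<phi>\<close>.\<close>
    have "\<phi> (FObj F X) \<cdot> v X = FMap F (\<xi> (FObj F X)) \<cdot> FMap F (\<delta> X) \<cdot> s X"
      using X by (simp add: \<phi> s_eqs assoc)
    also have "\<dots> = FMap F (\<xi> (FObj F X) \<cdot> \<delta> X) \<cdot> s X"
      using X by (simp add: assoc)
    also have "\<dots> = s X"
      using X by (simp only: comonad_eqs) simp
    finally have 1: "\<phi> (FObj F X) \<cdot> v X = s X" .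
    \<comment> \<open>The identity of \<open>K\<close> is inserted as \<open>\<delta>c s\<close>,
      after which \<open>w \<delta>c = 1 - \<delta> F\<xi>\<close> applies.\<close>
    have "w X = w X \<cdot> \<delta>c X \<cdot> s X"
      using X by (simp add: s_eqs)
    also have "\<dots> = (w X \<cdot> \<delta>c X) \<cdot> s X"
      using X by (simp add: assoc)
    also have "\<dots> = s X \<oplus> Neg C (\<delta> X \<cdot> \<phi> X)"
      using X by (simp add: w_deltac comp_add comp_neg assoc \<phi>)
    finally show "w X = \<phi> (FObj F X) \<cdot> v X \<oplus> Neg C (\<delta> X \<cdot> \<phi> X)"
      by (simp only: 1)
  qed
next
  assume "cointegration C F \<delta> (K, u, v) (F, \<delta>, \<delta>) w \<and>
    (\<exists>\<phi>. nat_trans C K F \<phi> \<and> (\<forall>X\<in>Obj C. \<delta> X \<cdot> \<phi> X = FMap F (\<phi> X) \<cdot> u X) \<and>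
      (\<forall>X\<in>Obj C. w X = \<phi> (FObj F X) \<cdot> v X \<oplus> Neg C (\<delta> X \<cdot> \<phi> X)))"
  then obtain \<phi> where nat_\<phi>: "nat_trans C K F \<phi>"
    and \<phi>_left: "\<And>X. X \<in> Obj C \<Longrightarrow> \<delta> X \<cdot> \<phi> X = FMap F (\<phi> X) \<cdot> u X"
    and w_eq: "\<And>X. X \<in> Obj C \<Longrightarrow> w X = \<phi> (FObj F X) \<cdot> v X \<oplus> Neg C (\<delta> X \<cdot> \<phi> X)"
    by blast
  note [simp] = nat_trans_simps[OF nat_\<phi>]
  define s where "s = at_functor C \<phi> F \<bullet> v"
  have s: "s X = \<phi> (FObj F X) \<cdot> v X" if "X \<in> Obj C" for X
    using that by (simp add: s_def)
  show "\<exists>s. bicomod_hom (K, u, v) (fcomp C F F, at_functor C \<delta> F, functor_on C F \<delta>) s \<and>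
    (\<forall>X\<in>Obj C. \<delta>c X \<cdot> s X = Ident C (FObj K X))"
    unfolding bicomodule_hom_iff
  proof (intro exI conjI ballI)
    show "nat_trans C K (fcomp C F F) s"
      unfolding s_def
      by (rule nat_trans_ncomp[OF _ _ _ K_nat(2) nat_trans_at_functor[OF F nat_\<phi>]]) simp_all
    fix X assume X: "X \<in> Obj C"
    have "\<delta> (FObj F X) \<cdot> s X = (\<delta> (FObj F X) \<cdot> \<phi> (FObj F X)) \<cdot> v X"
      using X by (simp add: s assoc)
    also have "\<dots> = FMap F (\<phi> (FObj F X)) \<cdot> u (FObj F X) \<cdot> v X"
      using X by (simp add: \<phi>_left assoc)
    finally show "at_functor C \<delta> F X \<cdot> s X = FMap F (s X) \<cdot> u X"
      using X by (simp add: s assoc K_eqs)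
    \<comment> \<open>Although \<open>\<phi>\<close> is colinear on the left only, \<open>s\<close>
      is right colinear: naturality of \<open>\<phi>\<close> at \<open>\<delta> X\<close> leaves
      coassociativity of \<open>v\<close>.\<close>
    have "FMap F (\<delta> X) \<cdot> s X = (FMap F (\<delta> X) \<cdot> \<phi> (FObj F X)) \<cdot> v X"
      using X by (simp add: s assoc)
    also have "\<dots> = \<phi> (FObj F (FObj F X)) \<cdot> FMap K (\<delta> X) \<cdot> v X"
      using X naturality[OF nat_\<phi>, of "\<delta> X" "FObj F (FObj F X)"] by (simp add: assoc[symmetric])
    finally show "functor_on C F \<delta> X \<cdot> s X = s (FObj F X) \<cdot> v X"
      using X by (simp add: s assoc K_eqs)
    have "(\<delta>c X \<cdot> \<delta> X) \<cdot> \<phi> X = Zero C (FObj K X) (FObj K X)"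
      using X by (simp add: deltac_eqs)
    then have "\<delta>c X \<cdot> \<delta> X \<cdot> \<phi> X = Zero C (FObj K X) (FObj K X)"
      using X by (simp add: assoc)
    \<comment> \<open>The correction term \<open>\<delta> \<phi>\<close> is killed by
      \<open>\<delta>c\<close>, so \<open>s\<close> is a section because \<open>w\<close> is
      one.\<close>
    then have "\<delta>c X \<cdot> w X = \<delta>c X \<cdot> s X"
      using X by (simp add: w_eq s comp_add comp_neg)
    then show "\<delta>c X \<cdot> s X = Ident C (FObj K X)"
      using X by (simp add: deltac_w)
  qed
qed

text \<open>Left comodule morphisms from \<open>K\<close> to \<open>F\<close> correspond to
  transformations from \<open>K\<close> to the identity functor, through \<open>\<xi>\<close> in one
  direction and \<open>F(-) u\<close> in the other. Applying \<open>\<xi>\<^sub>F\<close> to the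
  inner formula for \<open>w\<close> gives the one for \<open>d\<close>, and \<open>F(-) u\<close>
  reverses this.\<close>

lemma inner_w_iff_inner_d:
  "inner_cointegration C F \<delta> (K, u, v) (bicomod_F F \<delta>) w \<longleftrightarrow> inner_coderivation C F \<delta> (K, u, v) d"
  unfolding bicomod_F_def inner_cointegration_iff inner_coderivation_iff
proof (intro iffI conjI cointegration_w coderivation_d)
  assume "cointegration C F \<delta> (K, u, v) (F, \<delta>, \<delta>) w \<and>
    (\<exists>\<phi>. nat_trans C K F \<phi> \<and> (\<forall>X\<in>Obj C. \<delta> X \<cdot> \<phi> X = FMap F (\<phi> X) \<cdot> u X) \<and>
      (\<forall>X\<in>Obj C. w X = \<phi> (FObj F X) \<cdot> v X \<oplus> Neg C (\<delta> X \<cdot> \<phi> X)))"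
  then obtain \<phi> where nat_\<phi>: "nat_trans C K F \<phi>"
    and \<phi>_left: "\<And>X. X \<in> Obj C \<Longrightarrow> \<delta> X \<cdot> \<phi> X = FMap F (\<phi> X) \<cdot> u X"
    and w_eq: "\<And>X. X \<in> Obj C \<Longrightarrow> w X = \<phi> (FObj F X) \<cdot> v X \<oplus> Neg C (\<delta> X \<cdot> \<phi> X)"
    by blast
  note [simp] = nat_trans_simps[OF nat_\<phi>]
  define l where "l = nneg C (\<xi> \<bullet> \<phi>)"
  have l: "l X = Neg C (\<xi> X \<cdot> \<phi> X)" if "X \<in> Obj C" for X
    using that by (simp add: l_def)
  show "\<exists>l. nat_trans C K (id_functor C) l \<and>
    (\<forall>X\<in>Obj C. d X = l (FObj F X) \<cdot> v X \<oplus> Neg C (FMap F (l X) \<cdot> u X))"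
  proof (intro exI conjI ballI)
    show "nat_trans C K (id_functor C) l"
      unfolding l_def by (intro nat_trans_nneg nat_trans_ncomp[OF _ _ _ nat_\<phi> nat_xi]) simp_all
    fix X assume X: "X \<in> Obj C"
    let ?FX = "FObj F X"
    \<comment> \<open>Left colinearity of \<open>\<phi>\<close> and the counit law show that
      \<open>\<phi>\<close> is recovered from \<open>\<xi> \<phi>\<close>, hence from
      \<open>l\<close> up to sign.\<close>
    have "FMap F (\<xi> X \<cdot> \<phi> X) \<cdot> u X = (FMap F (\<xi> X) \<cdot> \<delta> X) \<cdot> \<phi> X"
      using X by (simp add: assoc \<phi>_left)
    then have 1: "FMap F (l X) \<cdot> u X = Neg C (\<phi> X)"
      using X by (simp add: l comonad_eqs comp_neg)
    have "(\<xi> ?FX \<cdot> \<delta> X) \<cdot> \<phi> X = \<phi> X"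
      using X by (simp add: comonad_eqs)
    then have "\<xi> ?FX \<cdot> \<delta> X \<cdot> \<phi> X = \<phi> X"
      using X by (simp add: assoc)
    then have "d X = \<phi> X \<oplus> Neg C (\<xi> ?FX \<cdot> \<phi> ?FX \<cdot> v X)"
      using X by (simp add: d_eq w_eq comp_add comp_neg neg_diff)
    also have "\<dots> = Neg C (\<xi> ?FX \<cdot> \<phi> ?FX \<cdot> v X) \<oplus> \<phi> X"
      using X by (intro padd_commute) simp_all
    finally show "d X = l ?FX \<cdot> v X \<oplus> Neg C (FMap F (l X) \<cdot> u X)"
      using X unfolding 1 by (simp add: l comp_neg assoc)
  qed
next
  assume "coderivation C F \<delta> (K, u, v) d \<and> (\<exists>l. nat_trans C K (id_functor C) l \<and>
    (\<forall>X\<in>Obj C. d X = l (FObj F X) \<cdot> v X \<oplus> Neg C (FMap F (l X) \<cdot> u X)))"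
  then obtain l where nat_l: "nat_trans C K (id_functor C) l"
    and d_inner: "\<And>X. X \<in> Obj C \<Longrightarrow> d X = l (FObj F X) \<cdot> v X \<oplus> Neg C (FMap F (l X) \<cdot> u X)"
    by blast
  have [simp]: "arr (l X)" "dm (l X) = FObj K X" "cd (l X) = X" if "X \<in> Obj C" for X
    using nat_trans_simps[OF nat_l that] that by simp_all
  define \<phi> where "\<phi> = nneg C (functor_on C F l \<bullet> u)"
  have \<phi>: "\<phi> X = Neg C (FMap F (l X) \<cdot> u X)" if "X \<in> Obj C" for X
    using that by (simp add: \<phi>_def)
  show "\<exists>\<phi>. nat_trans C K F \<phi> \<and> (\<forall>X\<in>Obj C. \<delta> X \<cdot> \<phi> X = FMap F (\<phi> X) \<cdot> u X) \<and>
      (\<forall>X\<in>Obj C. w X = \<phi> (FObj F X) \<cdot> v X \<oplus> Neg C (\<delta> X \<cdot> \<phi> X))"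
  proof (intro exI conjI ballI)
    have "nat_trans C (fcomp C F K) F (functor_on C F l)"
      using nat_trans_functor_on[OF F _ additive_id_functor nat_l] by (simp add: fcomp_id)
    then show "nat_trans C K F \<phi>"
      unfolding \<phi>_def by (intro nat_trans_nneg nat_trans_ncomp[OF _ _ _ K_nat(1)]) simp_all
    fix X assume X: "X \<in> Obj C"
    let ?FX = "FObj F X"
    \<comment> \<open>This is left colinearity of the map into the cofree left comodule
      \<open>F\<close> induced by \<open>l\<close>.\<close>
    have "\<delta> X \<cdot> FMap F (l X) \<cdot> u X = (\<delta> X \<cdot> FMap F (l X)) \<cdot> u X"
      using X by (simp add: assoc)
    also have "\<dots> = FMap F (FMap F (l X)) \<cdot> \<delta> (FObj K X) \<cdot> u X"
      using X by (simp add: delta_natural assoc)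
    finally have 1: "\<delta> X \<cdot> FMap F (l X) \<cdot> u X = FMap F (FMap F (l X) \<cdot> u X) \<cdot> u X"
      using X by (simp add: K_eqs assoc)
    then show "\<delta> X \<cdot> \<phi> X = FMap F (\<phi> X) \<cdot> u X"
      using X by (simp add: \<phi> comp_neg del: functor_simps(2))
    have "Neg C (d X) = FMap F (l X) \<cdot> u X \<oplus> Neg C (l ?FX \<cdot> v X)"
      using X by (simp add: d_inner neg_diff)
    then have xi_w: "\<xi> ?FX \<cdot> w X = FMap F (l X) \<cdot> u X \<oplus> Neg C (l ?FX \<cdot> v X)"
      using X by (simp add: d_eq)
    \<comment> \<open>Since \<open>w\<close> is left colinear, it is determined by
      \<open>\<xi>\<^sub>F w\<close>, which is \<open>- d\<close>.\<close>
    have "w X = FMap F (\<xi> ?FX) \<cdot> \<delta> ?FX \<cdot> w X"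
      using X comonad_eqs(2)[of ?FX] by (simp add: assoc[symmetric])
    also have "\<dots> = FMap F (\<xi> ?FX \<cdot> w X) \<cdot> u X"
      using X by (simp add: w_left assoc)
    also have "\<dots> = FMap F (FMap F (l X) \<cdot> u X) \<cdot> u X \<oplus> Neg C (FMap F (l ?FX \<cdot> v X) \<cdot> u X)"
      using X unfolding xi_w by (simp add: comp_add comp_neg)
    \<comment> \<open>Fact \<open>1\<close> rewrites the first term. In the second, compatibility of
      \<open>u\<close> and \<open>v\<close> replaces \<open>Fv u\<close> by
      \<open>u\<^sub>F v\<close>, which leaves \<open>\<phi>\<^sub>F v\<close>.\<close>
    also have "\<dots> = Neg C (\<delta> X \<cdot> \<phi> X) \<oplus> \<phi> ?FX \<cdot> v X"
      using X by (simp add: \<phi> comp_neg 1[symmetric] assoc K_eqs del: functor_simps(2))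
        (simp add: K_eqs assoc)
    also have "\<dots> = \<phi> ?FX \<cdot> v X \<oplus> Neg C (\<delta> X \<cdot> \<phi> X)"
      using X by (intro padd_commute) (simp_all add: \<phi>)
    finally show "w X = \<phi> ?FX \<cdot> v X \<oplus> Neg C (\<delta> X \<cdot> \<phi> X)" .
  qed
qed

end

theorem corollary2p4:
  fixes A :: "('o, 'm) precat"
    and F K :: "('o, 'm) endofunctor"
    and \<delta> \<xi> \<delta>c u v w d :: "'o \<Rightarrow> 'm"
  assumes "grothendieck_category TYPE('u) A"
    and "comonad A F \<delta> \<xi>"
    and "right_exact A F"
    and "commutes_with_direct_sums TYPE('u) A F"
    and "cokernel (bicomodule_category TYPE('u) A F \<delta> \<xi>)
           (bicomod_F F \<delta>) (bicomod_FF A F \<delta>) (bicomod_F F \<delta>, \<delta>, bicomod_FF A F \<delta>)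
           (K, u, v) (bicomod_FF A F \<delta>, \<delta>c, (K, u, v))"
    and "universal_cointegration A F \<delta> \<xi> K u \<delta>c w"
    and "d = universal_coderivation A F \<xi> w"
  shows
    "(split_short (bicomodule_category TYPE('u) A F \<delta> \<xi>)
        (bicomod_F F \<delta>) (bicomod_FF A F \<delta>) (K, u, v)
        (bicomod_F F \<delta>, \<delta>, bicomod_FF A F \<delta>) (bicomod_FF A F \<delta>, \<delta>c, (K, u, v))
      \<longleftrightarrow> inner_cointegration A F \<delta> (K, u, v) (bicomod_F F \<delta>) w)
     \<and> (inner_cointegration A F \<delta> (K, u, v) (bicomod_F F \<delta>) w
      \<longleftrightarrow> inner_coderivation A F \<delta> (K, u, v) d)"
proof -
  have A: "abelian_category A"
    using assms(1) unfolding grothendieck_category_def by blast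
  interpret preadditive_category A
    using A by (rule abelian_category.axioms)
  interpret comonad_universal A "TYPE('u)" F \<delta> \<xi> K u v \<delta>c w
    by unfold_locales (use assms in auto)
  \<comment> \<open>The split sequence refers to a zero bicomodule, obtained here from a zero object
    of \<open>A\<close>.\<close>
  obtain z where "zero_object A z"
    using abelian_category.has_zero[OF A] by blast
  then obtain N where N: "zero_object Bicat N"
    using bicat_zero_object by blast
  show ?thesis
    unfolding assms(7) inner_w_iff_inner_d[symmetric] inner_w_iff_split_epi
      bicat.split_short_iff_split_epi[OF N kernel_deltac] by blast
qed

end
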